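(* (i) Let $\beta\ge 0$, let $\Omega_1\subset\mathbb{R}^N$ be a box, and define $\Omega_t=t\,\Omega_1$ for $t>0$. Then the function $t\mapsto\lambda_1(\Omega_t)$ on $(0,\infty)$ is decreasing, convex, AG-convex and HA-convex. (ii) Let $\beta=0$ and let $\Omega_1\subset\mathbb{R}^N$ be any bounded simply-connected domain with piecewise $C^1$ boundary (not merely a box), and define $\Omega_t=t\,\Omega_1$ for $t>0$. Then the function $t\mapsto\lambda_1(\Omega_t)$ on $(0,\infty)$ is completely monotone.
   Context: A box is a set $\Omega(\mathbf a)=(-a_1,a_1)\times\cdots\times(-a_N,a_N)\subset\mathbb{R}^N$ with all $a_j>0$. For given $\beta\ge 0$, $\lambda_1(\Omega)$ denotes the fundamental (smallest) Robin eigenvalue of the Laplacian, i.e. the smallest $\lambda$ for which there is a function $u$, not identically zero, with $\Delta u+\lambda u=0$ in $\Omega$ and $\beta\,\partial u/\partial n+u=0$ on $\partial\Omega$ ($n$ the outward normal); $\beta=0$ is the Dirichlet case. For boxes it is given by the explicit formula $\lambda_1(\Omega(\mathbf a))=\sum_{j=1}^N\mu(a_j)^2$, where, if $\beta>0$, $\mu(c)$ is the unique solution in $(0,\pi/(2c))$ of $\mu\tan(c\mu)=1/\beta$, and, if $\beta=0$, $\mu(c)=\pi/(2c)$. A function $f:(0,\infty)\to(0,\infty)$ is AG-convex if $\log f$ is convex, and HA-convex if $x\mapsto f(1/x)$ is convex on $(0,\infty)$. It is completely monotone if it has derivatives of all orders and $(-1)^n f^{(n)}(x)\ge 0$ for all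 $x>0$ and all integers $n\ge 0$. *)

theory Defs
  imports "HOL-Analysis.Analysis"
begin

text \<open>The differentiability classes below are meant for open sets: derivatives are unrestricted ones.\<close>

definition partial :: "'a::euclidean_space \<Rightarrow> ('a \<Rightarrow> real) \<Rightarrow> 'a \<Rightarrow> real" where
  "partial i f x = frechet_derivative f (at x) i"

definition C1_on :: "'a::euclidean_space set \<Rightarrow> ('a \<Rightarrow> real) \<Rightarrow> bool" where
  "C1_on S f \<longleftrightarrow> (\<forall>x\<in>S. f differentiable (at x)) \<and> (\<forall>i\<in>Basis. continuous_on S (partial i f))"

definition C2_on :: "'a::euclidean_space set \<Rightarrow> ('a \<Rightarrow> real) \<Rightarrow> bool" where
  "C2_on S f \<longleftrightarrow> C1_on S f \<and> (\<forall>i\<in>Basis. C1_on S (partial i f))"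

definition laplacian :: "('a::euclidean_space \<Rightarrow> real) \<Rightarrow> 'a \<Rightarrow> real" where
  "laplacian f x = (\<Sum>i\<in>Basis. partial i (partial i f) x)"

text \<open>A boundary point has a normal only where the boundary is locally a regular level set of a
  \<open>C\<^sup>1\<close> function with the domain on one side; e.g. there is none on the edges of a box.\<close>

definition outward_unit_normal :: "'a::euclidean_space set \<Rightarrow> 'a \<Rightarrow> 'a \<Rightarrow> bool" where
  "outward_unit_normal \<Omega> p n \<longleftrightarrow> norm n = 1 \<and>
     (\<exists>U g c. open U \<and> p \<in> U \<and> C1_on U g \<and> g p = 0 \<and> 0 < c \<and> (GDERIV g p :> c *\<^sub>R n) \<and>
              \<Omega> \<inter> U = {x\<in>U. g x < 0})"

text \<open>Solutions are classical: twice continuously differentiable in \<open>\<Omega>\<close> and continuous on its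
  closure. For \<open>\<beta> = 0\<close> the boundary condition does not involve \<open>\<partial>u/\<partial>n\<close> and no regularity of the
  gradient at the boundary is asked for. For \<open>\<beta> > 0\<close> the gradient extends continuously to the
  closure (the extension is \<open>G\<close>), so that \<open>\<partial>u/\<partial>n = G \<bullet> n\<close>.\<close>

definition robin_boundary_condition ::
    "real \<Rightarrow> 'a::euclidean_space set \<Rightarrow> ('a \<Rightarrow> real) \<Rightarrow> bool" where
  "robin_boundary_condition \<beta> \<Omega> u \<longleftrightarrow>
     (if \<beta> = 0 then (\<forall>p\<in>frontier \<Omega>. u p = 0)
      else (\<exists>G. continuous_on (closure \<Omega>) G \<and> (\<forall>x\<in>\<Omega>. GDERIV u x :> G x) \<and>
                (\<forall>p\<in>frontier \<Omega>. \<forall>n. outward_unit_normal \<Omega> p n \<longrightarrow> \<beta> * (G p \<bullet> n) + u p = 0)))"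

definition robin_eigenvalue :: "real \<Rightarrow> 'a::euclidean_space set \<Rightarrow> real \<Rightarrow> bool" where
  "robin_eigenvalue \<beta> \<Omega> l \<longleftrightarrow>
     (\<exists>u. C2_on \<Omega> u \<and> continuous_on (closure \<Omega>) u \<and> (\<exists>x\<in>\<Omega>. u x \<noteq> 0) \<and>
          (\<forall>x\<in>\<Omega>. laplacian u x + l * u x = 0) \<and> robin_boundary_condition \<beta> \<Omega> u)"

definition is_fundamental_eigenvalue :: "real \<Rightarrow> 'a::euclidean_space set \<Rightarrow> real \<Rightarrow> bool" where
  "is_fundamental_eigenvalue \<beta> \<Omega> l \<longleftrightarrow>
     robin_eigenvalue \<beta> \<Omega> l \<and> (\<forall>m. robin_eigenvalue \<beta> \<Omega> m \<longrightarrow> l \<le> m)"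

text \<open>The fundamental eigenvalue as a function of the domain. Where there is no smallest classical
  eigenvalue, the function takes the dummy value \<open>0\<close>, which is not an eigenvalue of any bounded
  domain for \<open>\<beta> = 0\<close>.\<close>

definition fundamental_eigenvalue :: "real \<Rightarrow> 'a::euclidean_space set \<Rightarrow> real" where
  "fundamental_eigenvalue \<beta> \<Omega> =
     (if \<exists>l. is_fundamental_eigenvalue \<beta> \<Omega> l then THE l. is_fundamental_eigenvalue \<beta> \<Omega> l else 0)"

text \<open>Piecewise \<open>C\<^sup>1\<close> boundary: a finite union of patches, each the image of a closed cube of
  codimension one under a \<open>C\<^sup>1\<close> map that is a one-to-one immersion of the relative interior, and the
  domain lies on one side of its boundary near each interior point of a patch. The cube is realised
  as the face \<open>x \<bullet> k = 0\<close> of the unit cube, \<open>k\<close> a basis vector, which avoids a second type for the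
  parameter space; in dimension one the face is the single point \<open>0\<close>.\<close>

definition cube_face :: "'a::euclidean_space \<Rightarrow> 'a set" where
  "cube_face k = {x \<in> cbox 0 One. x \<bullet> k = 0}"

definition open_cube_face :: "'a::euclidean_space \<Rightarrow> 'a set" where
  "open_cube_face k = {x. x \<bullet> k = 0 \<and> (\<forall>b\<in>Basis - {k}. 0 < x \<bullet> b \<and> x \<bullet> b < 1)}"

definition C1_patch_param :: "'a::euclidean_space \<Rightarrow> ('a \<Rightarrow> 'a) \<Rightarrow> bool" where
  "C1_patch_param k \<phi> \<longleftrightarrow>
     (\<exists>U. open U \<and> cube_face k \<subseteq> U \<and> (\<forall>b\<in>Basis. C1_on U (\<lambda>x. \<phi> x \<bullet> b))) \<and>
     inj_on \<phi> (open_cube_face k) \<and>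
     (\<forall>x\<in>open_cube_face k. inj_on (frechet_derivative \<phi> (at x)) {v. v \<bullet> k = 0})"

definition piecewise_C1_boundary :: "'a::euclidean_space set \<Rightarrow> bool" where
  "piecewise_C1_boundary \<Omega> \<longleftrightarrow>
     (\<exists>k\<in>Basis. \<exists>\<Phi>. finite \<Phi> \<and> (\<forall>\<phi>\<in>\<Phi>. C1_patch_param k \<phi>) \<and>
        frontier \<Omega> = (\<Union>\<phi>\<in>\<Phi>. \<phi> ` cube_face k) \<and>
        (\<forall>\<phi>\<in>\<Phi>. \<forall>x\<in>open_cube_face k. \<exists>n. outward_unit_normal \<Omega> (\<phi> x) n))"

text \<open>Properties of functions on \<open>(0,\<infinity>)\<close>; values at arguments \<open>\<le> 0\<close> play no role.\<close>

definition AG_convex :: "(real \<Rightarrow> real) \<Rightarrow> bool" where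
  "AG_convex f \<longleftrightarrow> (\<forall>x>0. 0 < f x) \<and> convex_on {0<..} (\<lambda>x. ln (f x))"

definition HA_convex :: "(real \<Rightarrow> real) \<Rightarrow> bool" where
  "HA_convex f \<longleftrightarrow> (\<forall>x>0. 0 < f x) \<and> convex_on {0<..} (\<lambda>x. f (1 / x))"

definition completely_monotone :: "(real \<Rightarrow> real) \<Rightarrow> bool" where
  "completely_monotone f \<longleftrightarrow>
     (\<forall>n. \<forall>x>0. (deriv ^^ n) f differentiable (at x) \<and> 0 \<le> (-1) ^ n * (deriv ^^ n) f x)"

end

theory Submission
  imports Defs
begin

text \<open>
  Part (i) needs the value of the fundamental eigenvalue on a box. Separation of variables gives the
  eigenfunction \<open>\<Prod>\<^sub>j cos (\<mu>\<^sub>j x\<^sub>j)\<close> with eigenvalue \<open>\<Sum>\<^sub>j \<mu>\<^sub>j\<^sup>2\<close>, where \<open>\<beta> \<mu>\<^sub>j sin (\<mu>\<^sub>j a\<^sub>j) = cos (\<mu>\<^sub>j a\<^sub>j)\<close>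
  and \<open>0 < \<mu>\<^sub>j a\<^sub>j \<le> \<pi>/2\<close>; in this form the equation covers the Dirichlet case \<open>\<beta> = 0\<close> as well. No
  eigenvalue \<open>m\<close> is smaller, by a comparison argument that uses no integration by parts (a classical
  solution may have an irregular gradient at the boundary). If \<open>m < \<Sum>\<^sub>j \<mu>\<^sub>j\<^sup>2\<close>, the frequencies can be
  reduced a little, to \<open>\<nu>\<^sub>j < \<mu>\<^sub>j\<close> with \<open>m < \<Sum>\<^sub>j \<nu>\<^sub>j\<^sup>2\<close>. Then \<open>p = \<Prod>\<^sub>j cos (\<nu>\<^sub>j x\<^sub>j)\<close> is positive up to the
  boundary and satisfies \<open>\<beta> \<partial>p/\<partial>n + p > 0\<close> there. For an eigenfunction \<open>v\<close> to \<open>m\<close>, the quotient \<open>\<bar>v\<bar>/p\<close>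
  cannot have its maximum in the interior (lemma \<open>quotient_max_on_frontier\<close>), and the boundary
  condition excludes the boundary (lemma \<open>strict_robin_supersolution_not_touched\<close>).

  The eigenvalue of the dilated box is thus \<open>\<Sum>\<^sub>j \<mu>(t a\<^sub>j)\<^sup>2\<close>, and all asserted properties pass to sums
  and to dilations of the argument, so that only \<open>\<mu>(c)\<^sup>2\<close> has to be studied. For \<open>\<beta> = 0\<close> it is
  \<open>(\<pi>/(2 c))\<^sup>2\<close>. For \<open>\<beta> > 0\<close>, with \<open>y = c \<mu>(c)\<close>, one has
  \<open>c = \<beta> y tan y\<close> and \<open>\<mu> = 1/(\<beta> tan y)\<close>. Along this curve the derivative of \<open>ln \<mu>\<^sup>2\<close> with respect to
  \<open>c\<close> is \<open>- 2/(\<beta> E(y))\<close> and that of \<open>\<mu>\<^sup>2\<close> with respect to \<open>1/c\<close> is \<open>2 y\<^sup>2/(\<beta> E(y))\<close>, where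
  \<open>E(y) = sin\<^sup>2 y + y tan y\<close>. AG-convexity therefore means that \<open>E\<close> increases, which is clear, and
  HA-convexity that \<open>E(y)/y\<^sup>2\<close> increases. The latter is delicate, since \<open>E(y)/y\<^sup>2 = 2 + O(y\<^sup>4)\<close> near
  \<open>0\<close>; it reduces to \<open>4 - 4 cos z \<le> z\<^sup>2 + z sin z\<close> for \<open>z = 4 y\<close> between \<open>0\<close> and \<open>2 \<pi>\<close>. Convexity
  itself follows from AG-convexity by the inequality between the arithmetic and the geometric mean.

  Part (ii) is the scaling law \<open>\<lambda>\<^sub>1(t \<Omega>) = \<lambda>\<^sub>1(\<Omega>)/t\<^sup>2\<close>, valid for \<open>\<beta> = 0\<close> only, together with the
  positivity of Dirichlet eigenvalues, which is the comparison argument again, with a cosine product on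
  a large cube in the role of \<open>p\<close>. If there is no smallest eigenvalue, then the same holds for every
  dilate, and the function is \<open>0\<close>.
\<close>

section \<open>Maximum principle for quotients\<close>

lemma partial_eq:
  "(f has_derivative f') (at x) \<Longrightarrow> partial i f x = f' i"
  unfolding partial_def using frechet_derivative_at by metis

lemma has_derivative_partial:
  assumes "f differentiable (at x)"
  shows "(f has_derivative frechet_derivative f (at x)) (at x)"
  using assms frechet_derivative_works by blast

lemma has_real_derivative_along_line:
  fixes f :: "'a::euclidean_space \<Rightarrow> real"
  assumes "f differentiable (at (x + s *\<^sub>R d))"
  shows "((\<lambda>s. f (x + s *\<^sub>R d)) has_real_derivative partial d f (x + s *\<^sub>R d)) (at s)"
proof -
  let ?f' = "frechet_derivative f (at (x + s *\<^sub>R d))"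
  have f': "(f has_derivative ?f') (at (x + s *\<^sub>R d))"
    using assms by (rule has_derivative_partial)
  have "((\<lambda>s. x + s *\<^sub>R d) has_derivative (\<lambda>h. h *\<^sub>R d)) (at s)"
    by (auto intro!: derivative_eq_intros)
  from has_derivative_compose[OF this f']
  have "((\<lambda>s. f (x + s *\<^sub>R d)) has_derivative (\<lambda>h. ?f' (h *\<^sub>R d))) (at s)" .
  moreover have "?f' (h *\<^sub>R d) = partial d f (x + s *\<^sub>R d) * h" for h
    unfolding partial_def using linear_frechet_derivative[OF assms]
    by (simp add: linear_scale mult.commute)
  ultimately show ?thesis by (simp add: has_field_derivative_def)
qed

lemma second_derivative_at_max:
  fixes g :: "real \<Rightarrow> real"
  assumes "0 < d"
    and g': "\<And>s. \<bar>s\<bar> < d \<Longrightarrow> (g has_real_derivative g' s) (at s)"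
    and g'': "(g' has_real_derivative l) (at 0)"
    and max: "\<And>s. \<bar>s\<bar> < d \<Longrightarrow> g s \<le> g 0"
  shows "l \<le> 0"
proof (rule ccontr)
  assume "\<not> l \<le> 0"
  have "g' 0 = 0"
    by (rule DERIV_local_max[OF g'[of 0] \<open>0 < d\<close>]) (use \<open>0 < d\<close> max in auto)
  from DERIV_pos_inc_right[OF g''] \<open>\<not> l \<le> 0\<close> \<open>g' 0 = 0\<close>
  obtain e where e: "0 < e" "\<And>h. 0 < h \<Longrightarrow> h < e \<Longrightarrow> 0 < g' h" by auto
  define b where "b = min d e / 2"
  have b: "0 < b" "b < d" "b < e" using \<open>0 < d\<close> \<open>0 < e\<close> by (auto simp: b_def)
  have "g 0 < g b"
  proof (rule DERIV_pos_imp_increasing_open[OF b(1)])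
    show "\<exists>y. (g has_real_derivative y) (at s) \<and> 0 < y" if "0 < s" "s < b" for s
      using g'[of s] e(2)[of s] that b by auto
    show "continuous_on {0..b} g"
    proof (rule DERIV_atLeastAtMost_imp_continuous_on)
      show "\<exists>y. (g has_real_derivative y) (at s)" if "0 \<le> s" "s \<le> b" for s
        using g'[of s] that b by auto
    qed
  qed
  with max[of b] b show False by simp
qed

text \<open>The functions are kept apart, instead of taking their linear combination as a single function:
  \<open>partial\<close> of a combination is the combination of partial derivatives only where all of them exist,
  and restricting to lines avoids this.\<close>

lemma laplacian_at_max:
  fixes v p :: "'a::euclidean_space \<Rightarrow> real"
  assumes "open S" "x \<in> S" and v: "C2_on S v" and p: "C2_on S p"
    and max: "\<And>y. y \<in> S \<Longrightarrow> \<alpha> * v y + \<gamma> * p y \<le> \<alpha> * v x + \<gamma> * p x"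
  shows "\<alpha> * laplacian v x + \<gamma> * laplacian p x \<le> 0"
proof -
  obtain d where d: "0 < d" "ball x d \<subseteq> S"
    using assms(1,2) open_contains_ball by blast
  have "\<alpha> * partial i (partial i v) x + \<gamma> * partial i (partial i p) x \<le> 0"
    if i: "i \<in> Basis" for i :: 'a
  proof -
    have S: "x + s *\<^sub>R i \<in> S" if "\<bar>s\<bar> < d" for s
      using d i that by (auto simp: subset_eq dist_norm)
    have diff: "v differentiable (at y)" "p differentiable (at y)"
      "partial i v differentiable (at y)" "partial i p differentiable (at y)" if "y \<in> S" for y
      using v p i that by (auto simp: C2_on_def C1_on_def)
    show ?thesis
    proof (rule second_derivative_at_max[OF d(1)])
      fix s assume s: "\<bar>s\<bar> < d"
      show "((\<lambda>s. \<alpha> * v (x + s *\<^sub>R i) + \<gamma> * p (x + s *\<^sub>R i)) has_real_derivative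
          \<alpha> * partial i v (x + s *\<^sub>R i) + \<gamma> * partial i p (x + s *\<^sub>R i)) (at s)"
        by (intro DERIV_add DERIV_cmult has_real_derivative_along_line diff S s)
      show "\<alpha> * v (x + s *\<^sub>R i) + \<gamma> * p (x + s *\<^sub>R i) \<le> \<alpha> * v (x + 0 *\<^sub>R i) + \<gamma> * p (x + 0 *\<^sub>R i)"
        using max[OF S[OF s]] by simp
    next
      have "((\<lambda>s. \<alpha> * partial i v (x + s *\<^sub>R i) + \<gamma> * partial i p (x + s *\<^sub>R i)) has_real_derivative
          \<alpha> * partial i (partial i v) (x + 0 *\<^sub>R i) + \<gamma> * partial i (partial i p) (x + 0 *\<^sub>R i)) (at 0)"
        by (intro DERIV_add DERIV_cmult has_real_derivative_along_line diff) (simp_all add: assms(2))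
      then show "((\<lambda>s. \<alpha> * partial i v (x + s *\<^sub>R i) + \<gamma> * partial i p (x + s *\<^sub>R i)) has_real_derivative
          \<alpha> * partial i (partial i v) x + \<gamma> * partial i (partial i p) x) (at 0)"
        by simp
    qed
  qed
  then have "(\<Sum>i\<in>Basis. \<alpha> * partial i (partial i v) x + \<gamma> * partial i (partial i p) x) \<le> 0"
    by (rule sum_nonpos)
  then show ?thesis
    by (simp add: laplacian_def sum.distrib sum_distrib_left)
qed

text \<open>At an interior maximum \<open>z\<close> of \<open>\<bar>v\<bar>/p\<close>, with value \<open>M\<close>, the function \<open>sgn (v z) v - M p\<close> has
  its maximum \<open>0\<close>, so that its Laplacian \<open>- m sgn (v z) v + M l p = (l - m) M p\<close> is nonpositive
  there; but this number is positive. The absolute value spares the distinction between positive and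
  negative eigenfunctions.\<close>

lemma quotient_max_on_frontier:
  fixes v p :: "'a::euclidean_space \<Rightarrow> real"
  assumes "open S" "bounded S"
    and v: "C2_on S v" "continuous_on (closure S) v" "\<And>x. x \<in> S \<Longrightarrow> laplacian v x + m * v x = 0"
    and v_nz: "x \<in> S" "v x \<noteq> 0"
    and p: "C2_on S p" "continuous_on (closure S) p" "\<And>x. x \<in> S \<Longrightarrow> laplacian p x + l * p x = 0"
    and p_pos: "\<And>x. x \<in> closure S \<Longrightarrow> 0 < p x"
    and "m < l"
  obtains z M where "z \<in> frontier S" "0 < M" "\<bar>v z\<bar> = M * p z"
    "\<And>y. y \<in> closure S \<Longrightarrow> \<bar>v y\<bar> \<le> M * p y"
proof -
  have "compact (closure S)" using \<open>bounded S\<close> by simp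
  moreover have x: "x \<in> closure S" using v_nz(1) closure_subset by blast
  moreover have "continuous_on (closure S) (\<lambda>y. \<bar>v y\<bar> / p y)"
    by (intro continuous_intros v p) (use p_pos in force)
  ultimately have "\<exists>z\<in>closure S. \<forall>y\<in>closure S. \<bar>v y\<bar> / p y \<le> \<bar>v z\<bar> / p z"
    by (intro continuous_attains_sup) auto
  then obtain z where z: "z \<in> closure S"
    and max: "\<And>y. y \<in> closure S \<Longrightarrow> \<bar>v y\<bar> / p y \<le> \<bar>v z\<bar> / p z"
    by auto
  define M where "M = \<bar>v z\<bar> / p z"
  have M: "0 < M"
    using max[OF x] v_nz(2) p_pos[OF x] unfolding M_def
    by (smt (verit) divide_pos_pos zero_less_abs_iff)
  have vz: "\<bar>v z\<bar> = M * p z" using p_pos[OF z] by (simp add: M_def)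
  have le: "\<bar>v y\<bar> \<le> M * p y" if "y \<in> closure S" for y
    using max[OF that] p_pos[OF that] by (simp add: M_def pos_divide_le_eq)
  have "z \<notin> S"
  proof
    assume zS: "z \<in> S"
    have "sgn (v z) * laplacian v z + (- M) * laplacian p z \<le> 0"
    proof (rule laplacian_at_max[OF \<open>open S\<close> zS v(1) p(1)])
      fix y assume "y \<in> S"
      then have "y \<in> closure S" using closure_subset by blast
      from le[OF this] show "sgn (v z) * v y + (- M) * p y \<le> sgn (v z) * v z + (- M) * p z"
        using vz by (auto simp: sgn_if abs_if split: if_splits)
    qed
    moreover have "laplacian v z = - m * v z" "laplacian p z = - l * p z"
      using v(3)[OF zS] p(3)[OF zS] by linarith+
    ultimately have "M * l * p z \<le> m * (sgn (v z) * v z)" by (simp add: algebra_simps)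
    also have "sgn (v z) * v z = M * p z" using vz by (simp add: sgn_if abs_if split: if_splits)
    finally have "(l - m) * (M * p z) \<le> 0" by (simp add: algebra_simps)
    moreover have "0 < (l - m) * (M * p z)" using M p_pos[OF z] \<open>m < l\<close> by simp
    ultimately show False by simp
  qed
  with z \<open>open S\<close> have "z \<in> frontier S" by (simp add: frontier_def interior_open)
  from that[OF this M vz le] show thesis .
qed

section \<open>Cosine products\<close>

definition separable :: "('n::finite \<Rightarrow> real \<Rightarrow> real) \<Rightarrow> real^'n \<Rightarrow> real" where
  "separable f x = (\<Prod>i\<in>UNIV. f i (x $ i))"

lemma separable_split: "separable f x = f k (x $ k) * (\<Prod>i\<in>UNIV - {k}. f i (x $ i))"
  unfolding separable_def by (subst prod.remove[of UNIV k]) auto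

lemma separable_upd:
  "separable (f(k := g)) x = g (x $ k) * (\<Prod>i\<in>UNIV - {k}. f i (x $ i))"
  unfolding separable_split[of _ x k] by (auto intro!: prod.cong)

lemma continuous_on_separable:
  assumes "\<And>i. continuous_on UNIV (f i)"
  shows "continuous_on S (separable f)"
  unfolding separable_def
  by (intro continuous_on_prod continuous_on_compose2[OF assms] continuous_intros) auto

text \<open>The products are closed under partial differentiation: \<open>\<partial>/\<partial>x\<^sub>k\<close> replaces the factor number \<open>k\<close> by
  its derivative. Writing this as a function update makes second derivatives an instance of first ones.\<close>

lemma has_derivative_separable:
  fixes f f' :: "'n::finite \<Rightarrow> real \<Rightarrow> real"
  assumes "\<And>i y. (f i has_real_derivative f' i y) (at y)"
  shows "(separable f has_derivative (\<lambda>h. \<Sum>k\<in>UNIV. h $ k * separable (f(k := f' k)) x)) (at x)"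
proof -
  have nth: "((\<lambda>x. x $ i) has_derivative (\<lambda>h. h $ i)) (at x)" for i and x :: "real^'n"
    by (rule bounded_linear_imp_has_derivative[OF bounded_linear_vec_nth])
  have f: "(f i has_derivative (\<lambda>h. f' i y * h)) (at y)" for i y
    using assms by (simp add: has_field_derivative_def)
  have "((\<lambda>x. f i (x $ i)) has_derivative (\<lambda>h. f' i (x $ i) * h $ i)) (at x)" for i
    by (rule has_derivative_compose[OF nth f])
  from has_derivative_prod[of UNIV "\<lambda>i x. f i (x $ i)", OF this]
  show ?thesis
    unfolding separable_upd by (simp add: separable_def[abs_def] mult_ac)
qed

lemma GDERIV_separable:
  assumes "\<And>i y. (f i has_real_derivative f' i y) (at y)"
  shows "GDERIV (separable f) x :> (\<chi> k. separable (f(k := f' k)) x)"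
  using has_derivative_separable[OF assms] by (simp add: gderiv_def inner_vec_def)

lemma partial_separable:
  assumes "\<And>i y. (f i has_real_derivative f' i y) (at y)"
  shows "partial (axis k 1) (separable f) = separable (f(k := f' k))"
proof
  fix x
  show "partial (axis k 1) (separable f) x = separable (f(k := f' k)) x"
    by (subst partial_eq[OF has_derivative_separable[OF assms]])
      (simp add: axis_def if_distrib[of "\<lambda>c. c * _"] cong: if_cong)
qed

lemma Basis_cart: "(Basis :: (real^'n) set) = range (\<lambda>k. axis k 1)"
  by (auto simp: Basis_vec_def)

lemma sum_Basis_cart: "(\<Sum>i\<in>(Basis :: (real^'n) set). F i) = (\<Sum>k\<in>UNIV. F (axis k 1))"
  unfolding Basis_cart by (subst sum.reindex) (auto simp: inj_on_def axis_eq_axis)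

lemma C1_on_separable:
  assumes "\<And>i y. (f i has_real_derivative f' i y) (at y)"
    and "\<And>i. continuous_on UNIV (f' i)"
  shows "C1_on S (separable f)"
  unfolding C1_on_def Basis_cart
proof (intro conjI ballI)
  show "separable f differentiable (at x)" for x
    unfolding differentiable_def by (rule exI, rule has_derivative_separable[OF assms(1)])
  have "continuous_on UNIV (f i)" for i
    using assms(1) DERIV_continuous_on by blast
  then show "continuous_on S (partial i (separable f))" if "i \<in> range (\<lambda>k. axis k 1)" for i
    using that assms by (auto simp: partial_separable[OF assms(1)] intro!: continuous_on_separable)
qed

lemma
  assumes f: "\<And>i y. (f i has_real_derivative f' i y) (at y)"
    and f': "\<And>i y. (f' i has_real_derivative f'' i y) (at y)"
    and f'': "\<And>i. continuous_on UNIV (f'' i)"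
  shows C2_on_separable: "C2_on S (separable f)"
    and laplacian_separable: "laplacian (separable f) x = (\<Sum>k\<in>UNIV. separable (f(k := f'' k)) x)"
proof -
  have cont: "continuous_on UNIV (f' i)" for i
    using f' DERIV_continuous_on by blast
  have deriv: "((f(k := f' k)) i has_real_derivative (f'(k := f'' k)) i y) (at y)" for k i y
    using f f' by simp
  have "C1_on S (separable (f(k := f' k)))" for k
    by (rule C1_on_separable[OF deriv]) (use cont f'' in simp)
  with C1_on_separable[OF f cont] show "C2_on S (separable f)"
    by (auto simp: C2_on_def Basis_cart partial_separable[OF f])
  show "laplacian (separable f) x = (\<Sum>k\<in>UNIV. separable (f(k := f'' k)) x)"
    unfolding laplacian_def sum_Basis_cart partial_separable[OF f] partial_separable[OF deriv]
    by (simp only: fun_upd_same fun_upd_upd)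
qed

definition cos_product :: "('n::finite \<Rightarrow> real) \<Rightarrow> real^'n \<Rightarrow> real" where
  "cos_product \<mu> = separable (\<lambda>i y. cos (\<mu> i * y))"

definition cos_product_gradient :: "('n::finite \<Rightarrow> real) \<Rightarrow> real^'n \<Rightarrow> real^'n" where
  "cos_product_gradient \<mu> x =
     (\<chi> k. - \<mu> k * sin (\<mu> k * x $ k) * (\<Prod>i\<in>UNIV - {k}. cos (\<mu> i * x $ i)))"

lemma cos_product_split:
  "cos_product \<mu> x = cos (\<mu> k * x $ k) * (\<Prod>i\<in>UNIV - {k}. cos (\<mu> i * x $ i))"
  unfolding cos_product_def by (rule separable_split)

lemma GDERIV_cos_product: "GDERIV (cos_product \<mu>) x :> cos_product_gradient \<mu> x"
proof -
  have "((\<lambda>y. cos (\<mu> i * y)) has_real_derivative - \<mu> i * sin (\<mu> i * y)) (at y)" for i y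
    by (auto intro!: derivative_eq_intros)
  from GDERIV_separable[OF this] show ?thesis
    by (simp add: cos_product_def cos_product_gradient_def[abs_def] separable_upd)
qed

lemma continuous_on_cos_product: "continuous_on S (cos_product \<mu>)"
  unfolding cos_product_def by (intro continuous_on_separable continuous_intros)

lemma continuous_on_cos_product_gradient: "continuous_on S (cos_product_gradient \<mu>)"
  unfolding cos_product_gradient_def by (intro continuous_intros)

lemma
  shows C2_on_cos_product: "C2_on S (cos_product \<mu>)"
    and laplacian_cos_product: "laplacian (cos_product \<mu>) x + (\<Sum>k\<in>UNIV. (\<mu> k)\<^sup>2) * cos_product \<mu> x = 0"
proof -
  have 1: "((\<lambda>y. cos (\<mu> i * y)) has_real_derivative - \<mu> i * sin (\<mu> i * y)) (at y)" for i y
    by (auto intro!: derivative_eq_intros)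
  have 2: "((\<lambda>y. - \<mu> i * sin (\<mu> i * y)) has_real_derivative - (\<mu> i)\<^sup>2 * cos (\<mu> i * y)) (at y)" for i y
    by (auto intro!: derivative_eq_intros simp: power2_eq_square)
  have 3: "continuous_on UNIV (\<lambda>y. - (\<mu> i)\<^sup>2 * cos (\<mu> i * y))" for i
    by (intro continuous_intros)
  show "C2_on S (cos_product \<mu>)"
    unfolding cos_product_def by (rule C2_on_separable[OF 1 2 3])
  have "separable ((\<lambda>i y. cos (\<mu> i * y))(k := \<lambda>y. - (\<mu> k)\<^sup>2 * cos (\<mu> k * y))) x
      = - (\<mu> k)\<^sup>2 * cos_product \<mu> x" for k
    unfolding separable_upd cos_product_split[of _ _ k] by simp
  then have "laplacian (cos_product \<mu>) x = (\<Sum>k\<in>UNIV. - (\<mu> k)\<^sup>2 * cos_product \<mu> x)"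
    unfolding cos_product_def[of \<mu>, abs_def] laplacian_separable[OF 1 2 3] by simp
  then show "laplacian (cos_product \<mu>) x + (\<Sum>k\<in>UNIV. (\<mu> k)\<^sup>2) * cos_product \<mu> x = 0"
    by (simp add: sum_negf sum_distrib_right)
qed

lemma cos_product_pos:
  assumes "\<And>i. 0 \<le> \<mu> i" "\<And>i. \<bar>x $ i\<bar> \<le> r i" "\<And>i. \<mu> i * r i < pi / 2"
  shows "0 < cos_product \<mu> x"
  unfolding cos_product_def separable_def
proof (rule prod_pos)
  fix i
  have "\<bar>\<mu> i * x $ i\<bar> \<le> \<mu> i * r i"
    using assms(1,2)[of i] by (simp add: abs_mult mult_left_mono)
  with assms(3)[of i] show "0 < cos (\<mu> i * x $ i)"
    by (intro cos_gt_zero_pi) linarith+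
qed

section \<open>The fundamental eigenvalue of a box\<close>

lemma mem_symmetric_box: "x \<in> box (- a) a \<longleftrightarrow> (\<forall>j. \<bar>x $ j\<bar> < a $ j)" for x a :: "real^'n"
  by (auto simp: mem_box_cart abs_less_iff minus_less_iff)

lemma mem_symmetric_cbox: "x \<in> cbox (- a) a \<longleftrightarrow> (\<forall>j. \<bar>x $ j\<bar> \<le> a $ j)" for x a :: "real^'n"
  by (auto simp: mem_box_cart abs_le_iff minus_le_iff)

lemma closure_symmetric_box:
  fixes a :: "real^'n"
  assumes "\<And>j. 0 < a $ j"
  shows "closure (box (- a) a) = cbox (- a) a"
proof (rule closure_box)
  have "0 \<in> box (- a) a" using assms by (simp add: mem_symmetric_box)
  then show "box (- a) a \<noteq> {}" by blast
qed

lemma frontier_symmetric_boxE: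
  fixes a :: "real^'n"
  assumes "\<And>j. 0 < a $ j" "p \<in> frontier (box (- a) a)"
  obtains j where "\<bar>p $ j\<bar> = a $ j" "p \<in> cbox (- a) a"
proof -
  have "p \<in> cbox (- a) a" "p \<notin> box (- a) a"
    using assms by (auto simp: frontier_def closure_symmetric_box interior_open[OF open_box])
  then show thesis using that
    by (auto simp: mem_symmetric_box mem_symmetric_cbox not_less) (metis order_antisym)
qed

definition face_normal :: "real^'n \<Rightarrow> 'n \<Rightarrow> real^'n" where
  "face_normal p j = axis j (sgn (p $ j))"

lemma inner_face_normal: "x \<bullet> face_normal p j = sgn (p $ j) * x $ j"
  by (simp add: face_normal_def inner_axis)

lemma norm_face_normal: "p $ j \<noteq> 0 \<Longrightarrow> norm (face_normal p j) = 1"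
  by (simp add: norm_eq_1 inner_face_normal) (simp add: face_normal_def sgn_if)

lemma outward_unit_normal_face:
  fixes a :: "real^'n"
  assumes "\<bar>p $ j\<bar> = a $ j" "0 < a $ j" "\<And>i. i \<noteq> j \<Longrightarrow> \<bar>p $ i\<bar> < a $ i"
  shows "outward_unit_normal (box (- a) a) p (face_normal p j)"
proof -
  let ?e = "face_normal p j"
  let ?g = "\<lambda>x. x \<bullet> ?e - a $ j"
  let ?U = "(\<Inter>i\<in>UNIV - {j}. {x. \<bar>x $ i\<bar> < a $ i}) \<inter> {x. 0 < x \<bullet> ?e}"
  have pj: "p $ j \<noteq> 0" using assms by auto
  have D: "(?g has_derivative (\<lambda>h. h \<bullet> ?e)) (at x)" for x
    by (auto intro!: derivative_eq_intros)
  have "partial i ?g = (\<lambda>x. i \<bullet> ?e)" for i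
    by (rule ext) (rule partial_eq[OF D])
  then have "C1_on ?U ?g"
    unfolding C1_on_def differentiable_def using D by auto
  moreover have "open ?U"
    by (intro open_Int open_INT ballI open_Collect_less continuous_intros) auto
  moreover have "p \<in> ?U" "?g p = 0"
    using assms pj by (auto simp: inner_face_normal sgn_mult_self_eq abs_sgn mult.commute sgn_if)
  moreover have "GDERIV ?g p :> 1 *\<^sub>R ?e" using D by (simp add: gderiv_def)
  moreover have "box (- a) a \<inter> ?U = {x \<in> ?U. ?g x < 0}"
  proof -
    have "\<bar>x $ j\<bar> < a $ j \<longleftrightarrow> x \<bullet> ?e < a $ j" if "0 < x \<bullet> ?e" for x :: "real^'n"
      using that pj by (auto simp: inner_face_normal sgn_if split: if_splits)
    then have "x \<in> box (- a) a \<longleftrightarrow> x \<bullet> ?e < a $ j" if "x \<in> ?U" for x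
      using that unfolding mem_symmetric_box by (metis (no_types, lifting) Diff_iff INT_iff IntE
          UNIV_I mem_Collect_eq singletonD)
    then show ?thesis by auto
  qed
  ultimately show ?thesis
    unfolding outward_unit_normal_def using norm_face_normal[OF pj]
    by (intro conjI exI[of _ ?U] exI[of _ ?g] exI[of _ "1::real"]) simp_all
qed

text \<open>At an edge this shows that there is no normal, since \<open>n\<close> would have to be the normal of each of the
  faces that meet there. If \<open>n\<close> differed from the normal \<open>e\<close> of a face through \<open>p\<close>, the direction
  \<open>e - n\<close> would point into the box according to \<open>n\<close> and out of the face according to \<open>e\<close>.\<close>

lemma outward_unit_normal_unique:
  fixes a :: "real^'n"
  assumes "outward_unit_normal (box (- a) a) p n" "\<bar>p $ j\<bar> = a $ j" "0 < a $ j"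
  shows "n = face_normal p j"
proof (rule ccontr)
  let ?e = "face_normal p j"
  assume "n \<noteq> ?e"
  have pj: "p $ j \<noteq> 0" using assms by auto
  from assms(1) obtain U g c where n: "norm n = 1" and U: "open U" "p \<in> U" and g: "g p = 0" "0 < c"
    "GDERIV g p :> c *\<^sub>R n" "box (- a) a \<inter> U = {x \<in> U. g x < 0}"
    unfolding outward_unit_normal_def by blast
  define v where "v = ?e - n"
  have norms: "n \<bullet> n = 1" "?e \<bullet> ?e = 1"
    using n norm_face_normal[OF pj] by (simp_all add: norm_eq_1)
  have "0 < v \<bullet> v" using \<open>n \<noteq> ?e\<close> by (simp add: v_def)
  then have "n \<bullet> ?e < 1"
    using norms by (simp add: v_def inner_diff_left inner_diff_right inner_commute)
  moreover have "v \<bullet> n = n \<bullet> ?e - 1" "v \<bullet> ?e = 1 - n \<bullet> ?e"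
    using norms by (simp_all add: v_def inner_diff_left inner_diff_right inner_commute)
  ultimately have v: "v \<bullet> n < 0" "0 < v \<bullet> ?e" by simp_all
  have "((\<lambda>s. p + s *\<^sub>R v) has_derivative (\<lambda>h. h *\<^sub>R v)) (at 0)"
    by (auto intro!: derivative_eq_intros)
  from has_derivative_compose[OF this, of g "\<lambda>h. h \<bullet> c *\<^sub>R n"] g(3)
  have "((\<lambda>s. g (p + s *\<^sub>R v)) has_derivative (\<lambda>h. h * (c * (v \<bullet> n)))) (at 0)"
    by (simp add: gderiv_def algebra_simps)
  then have "((\<lambda>s. g (p + s *\<^sub>R v)) has_real_derivative c * (v \<bullet> n)) (at 0)"
    by (simp add: has_field_derivative_def mult_commute_abs)
  from DERIV_neg_dec_right[OF this] v(1) g(2)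
  obtain d where d: "0 < d" "\<And>h. 0 < h \<Longrightarrow> h < d \<Longrightarrow> g (p + h *\<^sub>R v) < 0"
    using g(1) by (auto simp: mult_pos_neg)
  have "((\<lambda>s. p + s *\<^sub>R v) \<longlongrightarrow> p + 0 *\<^sub>R v) (at_right 0)"
    by (intro tendsto_intros)
  then have "eventually (\<lambda>s. p + s *\<^sub>R v \<in> U) (at_right 0)"
    using U by (simp add: topological_tendstoD)
  moreover have "eventually (\<lambda>s. s < d) (at_right 0)"
    using d(1) by (simp add: eventually_at_right_field) blast
  moreover have "eventually (\<lambda>s::real. 0 < s) (at_right 0)"
    by (simp add: eventually_at_right_less)
  ultimately have "eventually (\<lambda>s. p + s *\<^sub>R v \<in> U \<and> s < d \<and> 0 < s) (at_right (0::real))"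
    by eventually_elim auto
  then obtain s where s: "p + s *\<^sub>R v \<in> U" "s < d" "0 < s"
    by (metis (no_types, lifting) eventually_happens' trivial_limit_at_right_real)
  then have "p + s *\<^sub>R v \<in> box (- a) a" using d(2)[OF s(3,2)] g(4) by auto
  then have "\<bar>(p + s *\<^sub>R v) $ j\<bar> < a $ j" by (simp only: mem_symmetric_box)
  moreover have "a $ j < (p + s *\<^sub>R v) \<bullet> ?e"
  proof -
    have "p \<bullet> ?e = a $ j" using assms(2) by (simp add: inner_face_normal abs_sgn mult.commute)
    then show ?thesis using s(3) v(2) by (simp add: inner_add_left)
  qed
  moreover have "x \<bullet> ?e \<le> \<bar>x $ j\<bar>" for x :: "real^'n"
    by (auto simp: inner_face_normal sgn_if)
  ultimately show False by (meson less_le_trans less_asym)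
qed

text \<open>The boundary condition refers to points with a normal, hence to the relatively open faces. By
  continuity it carries over to the edges, in one version for each adjacent face.\<close>

lemma robin_condition_on_closed_face:
  fixes a p :: "real^'n"
  assumes G: "continuous_on (cbox (- a) a) G" and u: "continuous_on (cbox (- a) a) u"
    and bc: "\<And>p n. p \<in> frontier (box (- a) a) \<Longrightarrow> outward_unit_normal (box (- a) a) p n \<Longrightarrow>
          \<beta> * (G p \<bullet> n) + u p = 0"
    and a: "\<And>j. 0 < a $ j" and p: "p \<in> cbox (- a) a" "\<bar>p $ j\<bar> = a $ j"
  shows "\<beta> * (G p \<bullet> face_normal p j) + u p = 0"
proof -
  \<comment> \<open>The path \<open>q\<close> approaches \<open>p\<close> within the closed face as \<open>s\<close> tends to \<open>1\<close>, and stays in the open face before.\<close>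
  define q where "q s = (\<chi> i. if i = j then p $ i else s * p $ i)" for s :: real
  have q1: "q 1 = p" by (simp add: q_def vec_eq_iff)
  have q_cbox: "q s \<in> cbox (- a) a" if "s \<in> {0..1}" for s
    unfolding mem_symmetric_cbox
  proof
    fix i show "\<bar>q s $ i\<bar> \<le> a $ i"
      using p(1) that mult_right_mono[of s 1 "\<bar>p $ i\<bar>"]
      by (auto simp: q_def mem_symmetric_cbox abs_mult intro: order_trans)
  qed
  have cont_q: "continuous_on {0..1} q"
  proof -
    have "continuous_on {0..1} (\<lambda>s. if i = j then p $ i else s * p $ i)" for i
      by (cases "i = j") (auto intro!: continuous_intros)
    then show ?thesis unfolding q_def by (intro continuous_on_vec_lambda)
  qed
  have "\<beta> * (G (q s) \<bullet> face_normal p j) + u (q s) = 0" if s: "s \<in> {0..<1}" for s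
  proof -
    have "\<bar>q s $ i\<bar> < a $ i" if "i \<noteq> j" for i
    proof -
      have "s * \<bar>p $ i\<bar> \<le> s * a $ i"
        using p(1) s by (intro mult_left_mono) (auto simp: mem_symmetric_cbox)
      also have "\<dots> < a $ i" using s a[of i] by simp
      finally show ?thesis using s that by (simp add: q_def abs_mult)
    qed
    moreover have qj: "q s $ j = p $ j" by (simp add: q_def)
    ultimately have "outward_unit_normal (box (- a) a) (q s) (face_normal (q s) j)"
      using outward_unit_normal_face[of "q s" j a] p(2) a by simp
    moreover have "q s \<in> frontier (box (- a) a)"
    proof -
      have "q s \<notin> box (- a) a" using qj p(2) unfolding mem_symmetric_box by (metis less_irrefl)
      then show ?thesis using q_cbox[of s] s closure_symmetric_box[OF a]
        by (simp add: frontier_def interior_open[OF open_box])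
    qed
    ultimately show ?thesis using bc qj by (simp add: face_normal_def)
  qed
  moreover have "continuous_on (closure {0..<1}) (\<lambda>s. \<beta> * (G (q s) \<bullet> face_normal p j) + u (q s))"
    using q_cbox
    by (auto intro!: continuous_intros continuous_on_compose2[OF G cont_q] continuous_on_compose2[OF u cont_q])
  moreover have "(1::real) \<in> closure {0..<1}" by simp
  ultimately have "\<beta> * (G (q 1) \<bullet> face_normal p j) + u (q 1) = 0"
    using continuous_constant_on_closure[of "{0..<1::real}" "\<lambda>s. \<beta> * (G (q s) \<bullet> face_normal p j) + u (q s)" 0 1]
    by simp
  then show ?thesis by (simp add: q1)
qed

lemma one_sided_derivative_at_max:
  fixes h h' :: "real \<Rightarrow> real"
  assumes "0 < d" and h: "continuous_on {0..d} h"
    and h': "\<And>s. 0 < s \<Longrightarrow> s < d \<Longrightarrow> (h has_real_derivative h' s) (at s)"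
    and cont: "continuous_on {0..d} h'"
    and max: "\<And>s. 0 \<le> s \<Longrightarrow> s \<le> d \<Longrightarrow> h s \<le> h 0"
  shows "h' 0 \<le> 0"
proof (rule ccontr)
  assume "\<not> h' 0 \<le> 0"
  have "0 \<in> {0..d}" using \<open>0 < d\<close> by simp
  with cont \<open>\<not> h' 0 \<le> 0\<close> obtain e where e: "0 < e"
    "\<And>s. s \<in> {0..d} \<Longrightarrow> dist s 0 < e \<Longrightarrow> dist (h' s) (h' 0) < h' 0"
    unfolding continuous_on_iff by (meson not_le)
  define b where "b = min d e / 2"
  have b: "0 < b" "b < d" "b < e" using \<open>0 < d\<close> e(1) by (auto simp: b_def)
  have "h 0 < h b"
  proof (rule DERIV_pos_imp_increasing_open[OF b(1)])
    show "\<exists>y. (h has_real_derivative y) (at s) \<and> 0 < y" if "0 < s" "s < b" for s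
      using h'[of s] e(2)[of s] that b by (intro exI[of _ "h' s"]) (auto simp: dist_real_def)
    show "continuous_on {0..b} h" using b by (intro continuous_on_subset[OF h]) auto
  qed
  with max[of b] b show False by simp
qed

text \<open>If \<open>z\<close> lies in several faces, a single normal direction may lead along the boundary, where nothing
  is known about the derivative of \<open>v\<close>. The sum \<open>d\<close> of all inward normals at \<open>z\<close> leads into the box,
  and adding up the boundary conditions of the faces gives the sign of the derivative of
  \<open>\<sigma> v - M p\<close> in this direction: it is positive, which contradicts the maximum at \<open>z\<close>.\<close>

lemma strict_robin_supersolution_not_touched:
  fixes a z :: "real^'n"
  assumes a: "\<And>j. 0 < a $ j" and "0 < \<beta>"
    and v: "continuous_on (cbox (- a) a) v" "continuous_on (cbox (- a) a) G"
      "\<And>x. x \<in> box (- a) a \<Longrightarrow> GDERIV v x :> G x"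
    and v_bc: "\<And>j. \<bar>z $ j\<bar> = a $ j \<Longrightarrow> \<beta> * (G z \<bullet> face_normal z j) + v z = 0"
    and p: "continuous_on (cbox (- a) a) p" "continuous_on (cbox (- a) a) H"
      "\<And>x. x \<in> box (- a) a \<Longrightarrow> GDERIV p x :> H x"
    and p_bc: "\<And>j. \<bar>z $ j\<bar> = a $ j \<Longrightarrow> 0 < \<beta> * (H z \<bullet> face_normal z j) + p z"
    and z: "z \<in> frontier (box (- a) a)" and "0 < M"
    and touch: "\<sigma> * v z = M * p z" and le: "\<And>y. y \<in> cbox (- a) a \<Longrightarrow> \<sigma> * v y \<le> M * p y"
  shows False
proof -
  define J where "J = {j. \<bar>z $ j\<bar> = a $ j}"
  obtain j0 where j0: "j0 \<in> J" and zc: "z \<in> cbox (- a) a"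
    using frontier_symmetric_boxE[OF a z] unfolding J_def by blast
  define d where "d = - (\<Sum>j\<in>J. face_normal z j)"
  have dj: "d $ j = (if j \<in> J then - sgn (z $ j) else 0)" for j
    by (simp add: d_def face_normal_def axis_def if_distrib cong: if_cong)
  \<comment> \<open>The step is at most the smallest half side, so that the path does not leave through an opposite face.\<close>
  define r where "r = Min (range (($) a))"
  have r: "0 < r" "\<And>j. r \<le> a $ j" using a by (auto simp: r_def)
  have path: "\<bar>(z + s *\<^sub>R d) $ j\<bar> < a $ j" if s: "0 < s" "s \<le> r" for s j
  proof (cases "j \<in> J")
    case True
    then show ?thesis using s r(2)[of j] a[of j] by (auto simp: dj J_def sgn_if)
  next
    case False
    then show ?thesis using zc by (auto simp: dj J_def mem_symmetric_cbox order_less_le)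
  qed
  have path_box: "z + s *\<^sub>R d \<in> box (- a) a" if "0 < s" "s \<le> r" for s
    using path[OF that] by (simp add: mem_symmetric_box)
  have path_cbox: "z + s *\<^sub>R d \<in> cbox (- a) a" if "s \<in> {0..r}" for s
    using path_box[of s] that zc box_subset_cbox by (cases "s = 0") auto
  have cont: "continuous_on {0..r} (\<lambda>s. z + s *\<^sub>R d)" by (intro continuous_intros)
  note compose = continuous_on_compose2[OF _ cont]
  have deriv: "((\<lambda>s. f (z + s *\<^sub>R d)) has_real_derivative d \<bullet> F (z + s *\<^sub>R d)) (at s)"
    if "GDERIV f (z + s *\<^sub>R d) :> F (z + s *\<^sub>R d)" for f s F
  proof -
    have "((\<lambda>s. z + s *\<^sub>R d) has_derivative (\<lambda>h. h *\<^sub>R d)) (at s)"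
      by (auto intro!: derivative_eq_intros)
    from has_derivative_compose[OF this that[unfolded gderiv_def]]
    show ?thesis by (simp add: has_field_derivative_def mult_commute_abs)
  qed
  define h' where "h' s = \<sigma> * (d \<bullet> G (z + s *\<^sub>R d)) - M * (d \<bullet> H (z + s *\<^sub>R d))" for s
  have "h' 0 \<le> 0"
  proof (rule one_sided_derivative_at_max[OF r(1)])
    let ?h = "\<lambda>s. \<sigma> * v (z + s *\<^sub>R d) - M * p (z + s *\<^sub>R d)"
    show "continuous_on {0..r} ?h"
      using path_cbox by (intro continuous_intros compose[OF v(1)] compose[OF p(1)]) auto
    show "continuous_on {0..r} h'"
      unfolding h'_def using path_cbox
      by (intro continuous_intros compose[OF v(2)] compose[OF p(2)]) auto
    show "(?h has_real_derivative h' s) (at s)" if "0 < s" "s < r" for s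
      unfolding h'_def using path_box[of s] that
      by (intro DERIV_diff DERIV_cmult deriv v(3) p(3)) auto
    show "?h s \<le> ?h 0" if "0 \<le> s" "s \<le> r" for s
      using le[OF path_cbox[of s]] touch that by simp
  qed
  have d_inner: "\<beta> * (d \<bullet> w) = - (\<Sum>j\<in>J. \<beta> * (w \<bullet> face_normal z j))" for w
    by (simp add: d_def inner_sum_right inner_commute[of _ w] sum_distrib_left)
  have G: "\<beta> * (d \<bullet> G z) = (\<Sum>j\<in>J. v z)"
    unfolding d_inner sum_negf[symmetric]
    by (intro sum.cong refl) (use v_bc in \<open>force simp: J_def\<close>)
  have H: "\<beta> * (d \<bullet> H z) < (\<Sum>j\<in>J. p z)"
    unfolding d_inner sum_negf[symmetric]
    by (intro sum_strict_mono) (use p_bc j0 in \<open>force simp: J_def\<close>)+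
  have "0 < (\<Sum>j\<in>J. \<sigma> * v z) - M * (\<beta> * (d \<bullet> H z))"
    using mult_strict_left_mono[OF H \<open>0 < M\<close>] touch by (simp add: mult.left_commute)
  also have "\<dots> = \<beta> * h' 0"
  proof -
    have "(\<Sum>j\<in>J. \<sigma> * v z) = \<sigma> * (\<beta> * (d \<bullet> G z))" unfolding G by simp
    then show ?thesis by (simp add: h'_def algebra_simps)
  qed
  finally show False using \<open>h' 0 \<le> 0\<close> \<open>0 < \<beta>\<close> by (simp add: zero_less_mult_iff)
qed

lemma cos_product_face:
  assumes "\<bar>x $ j\<bar> = r" "0 < r"
  shows "cos_product \<mu> x = cos (\<mu> j * r) * (\<Prod>i\<in>UNIV - {j}. cos (\<mu> i * x $ i))"
    and "cos_product_gradient \<mu> x \<bullet> face_normal x j =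
      - \<mu> j * sin (\<mu> j * r) * (\<Prod>i\<in>UNIV - {j}. cos (\<mu> i * x $ i))"
proof -
  have "x $ j = r \<or> x $ j = - r" using assms by auto
  then show "cos_product \<mu> x = cos (\<mu> j * r) * (\<Prod>i\<in>UNIV - {j}. cos (\<mu> i * x $ i))"
    "cos_product_gradient \<mu> x \<bullet> face_normal x j =
      - \<mu> j * sin (\<mu> j * r) * (\<Prod>i\<in>UNIV - {j}. cos (\<mu> i * x $ i))"
    using \<open>0 < r\<close> by (auto simp: cos_product_split[of _ _ j] inner_face_normal cos_product_gradient_def)
qed

text \<open>Existence is a computation. For minimality, reducing all frequencies by a factor \<open>s < 1\<close> makes the
  cosine product positive on the closed box and the boundary condition a strict inequality, while its
  eigenvalue stays above \<open>m\<close> if \<open>s\<close> is close to \<open>1\<close>.\<close>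

theorem is_fundamental_eigenvalue_box:
  fixes a :: "real^'n" and \<mu> :: "'n \<Rightarrow> real"
  assumes a: "\<And>j. 0 < a $ j" and "0 \<le> \<beta>" and \<mu>: "\<And>j. 0 < \<mu> j" "\<And>j. \<mu> j * a $ j \<le> pi / 2"
    and bc: "\<And>j. \<beta> * \<mu> j * sin (\<mu> j * a $ j) = cos (\<mu> j * a $ j)"
  shows "is_fundamental_eigenvalue \<beta> (box (- a) a) (\<Sum>j\<in>UNIV. (\<mu> j)\<^sup>2)"
  unfolding is_fundamental_eigenvalue_def
proof (intro conjI allI impI)
  let ?B = "box (- a) a" and ?L = "\<Sum>j\<in>UNIV. (\<mu> j)\<^sup>2"
  note closure = closure_symmetric_box[OF a]
  have "robin_boundary_condition \<beta> ?B (cos_product \<mu>)"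
  proof (cases "\<beta> = 0")
    case True
    have "cos_product \<mu> p = 0" if p: "p \<in> frontier ?B" for p
    proof -
      obtain j where "\<bar>p $ j\<bar> = a $ j" using frontier_symmetric_boxE[OF a p] by blast
      from cos_product_face(1)[OF this a] show ?thesis using bc[of j] True by simp
    qed
    with True show ?thesis by (simp add: robin_boundary_condition_def)
  next
    case False
    have "\<beta> * (cos_product_gradient \<mu> p \<bullet> n) + cos_product \<mu> p = 0"
      if p: "p \<in> frontier ?B" and n: "outward_unit_normal ?B p n" for p n
    proof -
      obtain j where j: "\<bar>p $ j\<bar> = a $ j" using frontier_symmetric_boxE[OF a p] by blast
      show ?thesis
        unfolding outward_unit_normal_unique[OF n j a] cos_product_face[OF j a] bc[symmetric]
        by (simp add: algebra_simps)
    qed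
    then show ?thesis
      using False continuous_on_cos_product_gradient GDERIV_cos_product
      by (auto simp: robin_boundary_condition_def intro!: exI[of _ "cos_product_gradient \<mu>"])
  qed
  moreover have "cos_product \<mu> 0 \<noteq> 0" by (simp add: cos_product_def separable_def)
  moreover have "0 \<in> ?B" using a by (simp add: mem_symmetric_box)
  ultimately show "robin_eigenvalue \<beta> ?B ?L"
    unfolding robin_eigenvalue_def
    by (intro exI[of _ "cos_product \<mu>"] conjI C2_on_cos_product continuous_on_cos_product ballI
        laplacian_cos_product bexI[of _ 0])
  fix m assume "robin_eigenvalue \<beta> ?B m"
  then obtain v y where v: "C2_on ?B v" "continuous_on (closure ?B) v" "y \<in> ?B" "v y \<noteq> 0"
    "\<And>x. x \<in> ?B \<Longrightarrow> laplacian v x + m * v x = 0" and v_bc: "robin_boundary_condition \<beta> ?B v"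
    unfolding robin_eigenvalue_def by blast
  show "?L \<le> m"
  proof (rule ccontr)
    assume "\<not> ?L \<le> m"
    have "((\<lambda>s. s\<^sup>2 * ?L) \<longlongrightarrow> 1\<^sup>2 * ?L) (at_left 1)" by (intro tendsto_intros)
    moreover have "m < 1\<^sup>2 * ?L" using \<open>\<not> ?L \<le> m\<close> by simp
    ultimately have "eventually (\<lambda>s. m < s\<^sup>2 * ?L) (at_left 1)"
      by (rule order_tendstoD)
    moreover have "eventually (\<lambda>s. s \<in> {0<..<1::real}) (at_left 1)"
      by (rule eventually_at_left_real) simp
    ultimately have "eventually (\<lambda>s. m < s\<^sup>2 * ?L \<and> s \<in> {0<..<1}) (at_left (1::real))"
      by eventually_elim auto
    then obtain s where s: "m < s\<^sup>2 * ?L" "0 < s" "s < 1"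
      using eventually_happens'[OF trivial_limit_at_left_real] by force
    define \<nu> where "\<nu> j = s * \<mu> j" for j
    have \<nu>: "0 < \<nu> j" "\<nu> j < \<mu> j" for j using s \<mu>(1)[of j] by (auto simp: \<nu>_def)
    then have \<nu>a: "\<nu> j * a $ j < \<mu> j * a $ j" for j using a by simp
    then have \<nu>_small: "0 < \<nu> j * a $ j" "\<nu> j * a $ j < pi / 2" for j
      using \<nu>(1)[of j] a[of j] less_le_trans[OF \<nu>a \<mu>(2)] by auto
    have strict: "\<beta> * \<nu> j * sin (\<nu> j * a $ j) < cos (\<nu> j * a $ j)" for j
    proof -
      have "sin (\<nu> j * a $ j) \<le> sin (\<mu> j * a $ j)"
        using \<nu>a[of j] \<nu>_small[of j] \<mu>(2)[of j] by (intro sin_monotone_2pi_le) auto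
      moreover have "0 \<le> sin (\<nu> j * a $ j)" using \<nu>_small[of j] by (intro sin_ge_zero) linarith+
      ultimately have "\<beta> * \<nu> j * sin (\<nu> j * a $ j) \<le> \<beta> * \<mu> j * sin (\<mu> j * a $ j)"
        using \<nu>[of j] \<open>0 \<le> \<beta>\<close> by (intro mult_mono) auto
      also have "\<dots> = cos (\<mu> j * a $ j)" by (rule bc)
      also have "\<dots> < cos (\<nu> j * a $ j)"
        using \<nu>a[of j] \<nu>_small[of j] \<mu>(2)[of j] by (intro cos_monotone_0_pi) auto
      finally show ?thesis .
    qed
    have pos: "0 < cos_product \<nu> x" if "x \<in> cbox (- a) a" for x
      by (rule cos_product_pos[of _ _ "($) a"])
        (use that \<nu> \<nu>_small in \<open>auto simp: mem_symmetric_cbox less_imp_le\<close>)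
    have \<nu>_sum: "(\<Sum>j\<in>UNIV. (\<nu> j)\<^sup>2) = s\<^sup>2 * ?L"
      by (simp add: \<nu>_def power_mult_distrib sum_distrib_left)
    obtain z M where z: "z \<in> frontier ?B" and M: "0 < M" and touch: "\<bar>v z\<bar> = M * cos_product \<nu> z"
      and le: "\<And>y. y \<in> closure ?B \<Longrightarrow> \<bar>v y\<bar> \<le> M * cos_product \<nu> y"
      using quotient_max_on_frontier[OF open_box bounded_box v(1,2,5,3,4) C2_on_cos_product
          continuous_on_cos_product laplacian_cos_product[of \<nu>]] pos s(1)
      unfolding \<nu>_sum closure by blast
    have zc: "z \<in> cbox (- a) a" using frontier_symmetric_boxE[OF a z] by blast
    have "v z \<noteq> 0" using touch M pos[OF zc] by auto
    show False
    proof (cases "\<beta> = 0")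
      case True
      with v_bc z \<open>v z \<noteq> 0\<close> show False by (simp add: robin_boundary_condition_def)
    next
      case False
      with v_bc obtain G where G: "continuous_on (cbox (- a) a) G" "\<And>x. x \<in> ?B \<Longrightarrow> GDERIV v x :> G x"
        "\<And>p n. p \<in> frontier ?B \<Longrightarrow> outward_unit_normal ?B p n \<Longrightarrow> \<beta> * (G p \<bullet> n) + v p = 0"
        unfolding robin_boundary_condition_def closure by auto
      note v_cont = v(2)[unfolded closure]
      show False
      proof (rule strict_robin_supersolution_not_touched[OF a _ v_cont G(1,2) _
            continuous_on_cos_product continuous_on_cos_product_gradient GDERIV_cos_product _ z M])
        show "0 < \<beta>" using False \<open>0 \<le> \<beta>\<close> by simp
        show "\<beta> * (G z \<bullet> face_normal z j) + v z = 0" if "\<bar>z $ j\<bar> = a $ j" for j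
          by (rule robin_condition_on_closed_face[OF G(1) v_cont G(3) a zc that])
        show "0 < \<beta> * (cos_product_gradient \<nu> z \<bullet> face_normal z j) + cos_product \<nu> z"
          if "\<bar>z $ j\<bar> = a $ j" for j
        proof -
          have "0 < (\<Prod>i\<in>UNIV - {j}. cos (\<nu> i * z $ i))"
            using pos[OF zc] unfolding cos_product_face(1)[OF that a]
            by (rule zero_less_mult_pos) (use \<nu>_small[of j] in \<open>simp add: cos_gt_zero\<close>)
          with strict[of j] have "0 < (cos (\<nu> j * a $ j) - \<beta> * \<nu> j * sin (\<nu> j * a $ j)) *
              (\<Prod>i\<in>UNIV - {j}. cos (\<nu> i * z $ i))" by simp
          then show ?thesis unfolding cos_product_face[OF that a] by (simp add: algebra_simps)
        qed
        show "sgn (v z) * v z = M * cos_product \<nu> z"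
          using touch by (simp add: abs_sgn mult.commute)
        show "sgn (v z) * v y \<le> M * cos_product \<nu> y" if "y \<in> cbox (- a) a" for y
          using le[unfolded closure, OF that] by (auto simp: sgn_if)
      qed
    qed
  qed
qed

section \<open>Dirichlet eigenvalues and dilations\<close>

lemma partial_cong_open:
  assumes "open S" "\<And>x. x \<in> S \<Longrightarrow> f x = g x" "x \<in> S" "f differentiable (at x)"
  shows "partial i g x = partial i f x"
proof -
  have "(g has_derivative frechet_derivative f (at x)) (at x)"
    using has_derivative_transform_within_open[OF has_derivative_partial[OF assms(4)] assms(1,3)] assms(2)
    by blast
  then show ?thesis using partial_eq partial_def by metis
qed

lemma C1_on_cong:
  assumes "open S" and eq: "\<And>x. x \<in> S \<Longrightarrow> f x = g x" and f: "C1_on S f"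
  shows "C1_on S g"
proof -
  have "g differentiable (at x)" if "x \<in> S" for x
    using has_derivative_transform_within_open[OF has_derivative_partial \<open>open S\<close> that] f that eq
    unfolding C1_on_def differentiable_def by blast
  moreover have "continuous_on S (partial i g)" if "i \<in> Basis" for i
  proof (rule continuous_on_eq)
    show "continuous_on S (partial i f)" using f that by (simp add: C1_on_def)
    show "partial i f x = partial i g x" if "x \<in> S" for x
      using partial_cong_open[OF \<open>open S\<close> eq that] f that by (simp add: C1_on_def)
  qed
  ultimately show ?thesis by (simp add: C1_on_def)
qed

lemma
  fixes f :: "'a::euclidean_space \<Rightarrow> real"
  assumes "f differentiable (at (r *\<^sub>R x))"
  shows differentiable_dilation: "(\<lambda>x. c * f (r *\<^sub>R x)) differentiable (at x)"
    and partial_dilation: "partial i (\<lambda>x. c * f (r *\<^sub>R x)) x = c * r * partial i f (r *\<^sub>R x)"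
proof -
  let ?f' = "frechet_derivative f (at (r *\<^sub>R x))"
  have "((\<lambda>x. r *\<^sub>R x) has_derivative (\<lambda>h. r *\<^sub>R h)) (at x)"
    by (auto intro!: derivative_eq_intros)
  from has_derivative_compose[OF this has_derivative_partial[OF assms]]
  have d: "((\<lambda>x. c * f (r *\<^sub>R x)) has_derivative (\<lambda>h. c * ?f' (r *\<^sub>R h))) (at x)"
    by (rule has_derivative_mult_right)
  then show "(\<lambda>x. c * f (r *\<^sub>R x)) differentiable (at x)"
    by (auto simp: differentiable_def)
  show "partial i (\<lambda>x. c * f (r *\<^sub>R x)) x = c * r * partial i f (r *\<^sub>R x)"
    using linear_frechet_derivative[OF assms] partial_eq[OF d]
    by (simp add: partial_def linear_scale)
qed

lemma C1_on_dilation: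
  assumes "C1_on S f" "\<And>x. x \<in> T \<Longrightarrow> r *\<^sub>R x \<in> S"
  shows "C1_on T (\<lambda>x. c * f (r *\<^sub>R x))"
proof -
  have diff: "f differentiable (at (r *\<^sub>R x))" if "x \<in> T" for x
    using assms that by (simp add: C1_on_def)
  have "continuous_on T (partial i (\<lambda>x. c * f (r *\<^sub>R x)))" if "i \<in> Basis" for i
  proof -
    have "continuous_on T (\<lambda>x. c * r * partial i f (r *\<^sub>R x))"
      using assms that
      by (intro continuous_intros continuous_on_compose2[of S "partial i f" T]) (auto simp: C1_on_def)
    then show ?thesis
      by (subst continuous_on_cong[OF refl partial_dilation[OF diff]])
  qed
  with diff show ?thesis unfolding C1_on_def by (blast intro: differentiable_dilation)
qed

lemma
  assumes "open T" and f: "C2_on S f" and T: "\<And>x. x \<in> T \<Longrightarrow> r *\<^sub>R x \<in> S"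
  shows C2_on_dilation: "C2_on T (\<lambda>x. c * f (r *\<^sub>R x))"
    and laplacian_dilation:
      "x \<in> T \<Longrightarrow> laplacian (\<lambda>x. c * f (r *\<^sub>R x)) x = c * r\<^sup>2 * laplacian f (r *\<^sub>R x)"
proof -
  have diff: "f differentiable (at (r *\<^sub>R x))"
    "i \<in> Basis \<Longrightarrow> partial i f differentiable (at (r *\<^sub>R x))" if "x \<in> T" for x i
    using f T that by (auto simp: C2_on_def C1_on_def)
  have eq: "c * r * partial i f (r *\<^sub>R x) = partial i (\<lambda>x. c * f (r *\<^sub>R x)) x" if "x \<in> T" for x i
    using partial_dilation[OF diff(1)[OF that]] by simp
  show "C2_on T (\<lambda>x. c * f (r *\<^sub>R x))"
    unfolding C2_on_def
  proof (intro conjI ballI)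
    show "C1_on T (\<lambda>x. c * f (r *\<^sub>R x))"
      by (rule C1_on_dilation[OF _ T]) (use f in \<open>simp add: C2_on_def\<close>)
    show "C1_on T (partial i (\<lambda>x. c * f (r *\<^sub>R x)))" if "i \<in> Basis" for i
    proof (rule C1_on_cong[OF \<open>open T\<close>])
      show "C1_on T (\<lambda>x. c * r * partial i f (r *\<^sub>R x))"
        by (rule C1_on_dilation[OF _ T]) (use f that in \<open>simp add: C2_on_def\<close>)
    qed (rule eq)
  qed
  show "laplacian (\<lambda>x. c * f (r *\<^sub>R x)) x = c * r\<^sup>2 * laplacian f (r *\<^sub>R x)" if x: "x \<in> T"
  proof -
    have "partial i (partial i (\<lambda>x. c * f (r *\<^sub>R x))) x = c * r\<^sup>2 * partial i (partial i f) (r *\<^sub>R x)"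
      if i: "i \<in> Basis" for i
    proof -
      have "partial i (partial i (\<lambda>x. c * f (r *\<^sub>R x))) x = partial i (\<lambda>x. c * r * partial i f (r *\<^sub>R x)) x"
        by (rule partial_cong_open[OF \<open>open T\<close> eq x differentiable_dilation[OF diff(2)[OF x i]]])
      also have "\<dots> = c * r * r * partial i (partial i f) (r *\<^sub>R x)"
        by (rule partial_dilation[OF diff(2)[OF x i]])
      finally show ?thesis by (simp add: power2_eq_square)
    qed
    then show ?thesis by (simp add: laplacian_def sum_distrib_left)
  qed
qed

lemma dilation_image_iff: "0 < t \<Longrightarrow> x \<in> (\<lambda>x. t *\<^sub>R x) ` S \<longleftrightarrow> (1 / t) *\<^sub>R x \<in> S"
  for x :: "'a::real_vector"
  by (force simp: image_iff)

lemma dirichlet_eigenvalue_dilation: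
  assumes "open \<Omega>" "0 < t" "robin_eigenvalue 0 \<Omega> l"
  shows "robin_eigenvalue 0 ((\<lambda>x. t *\<^sub>R x) ` \<Omega>) (l / t\<^sup>2)"
proof -
  let ?S = "(\<lambda>x. t *\<^sub>R x) ` \<Omega>"
  obtain u x where u: "C2_on \<Omega> u" "continuous_on (closure \<Omega>) u" "x \<in> \<Omega>" "u x \<noteq> 0"
    "\<And>x. x \<in> \<Omega> \<Longrightarrow> laplacian u x + l * u x = 0" "\<And>p. p \<in> frontier \<Omega> \<Longrightarrow> u p = 0"
    using assms(3) by (auto simp: robin_eigenvalue_def robin_boundary_condition_def)
  define w where "w = (\<lambda>x. 1 * u ((1 / t) *\<^sub>R x))"
  have S: "open ?S" using assms by (intro open_scaling) auto
  have mem: "(1 / t) *\<^sub>R x \<in> \<Omega>" if "x \<in> ?S" for x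
    using that dilation_image_iff[OF \<open>0 < t\<close>, of x \<Omega>] by simp
  have closure: "closure ?S = (\<lambda>x. t *\<^sub>R x) ` closure \<Omega>" by (simp add: closure_scaleR)
  have cl: "(1 / t) *\<^sub>R x \<in> closure \<Omega>" if "x \<in> closure ?S" for x
    using that dilation_image_iff[OF \<open>0 < t\<close>, of x "closure \<Omega>"] by (simp only: closure)
  have "C2_on ?S w" unfolding w_def by (rule C2_on_dilation[OF S u(1) mem])
  moreover have "continuous_on (closure ?S) w"
    unfolding w_def by (intro continuous_intros continuous_on_compose2[OF u(2)]) (use cl in auto)
  moreover have "t *\<^sub>R x \<in> ?S" "w (t *\<^sub>R x) \<noteq> 0" using u(3,4) \<open>0 < t\<close> by (auto simp: w_def)
  moreover have "laplacian w x + l / t\<^sup>2 * w x = 0" if "x \<in> ?S" for x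
  proof -
    have "laplacian w x = (1 / t)\<^sup>2 * laplacian u ((1 / t) *\<^sub>R x)"
      using laplacian_dilation[OF S u(1) mem that, of 1] unfolding w_def by simp
    then show ?thesis using u(5)[OF mem[OF that]]
      by (simp add: w_def power_one_over add_divide_distrib[symmetric])
  qed
  moreover have "robin_boundary_condition 0 ?S w"
    unfolding robin_boundary_condition_def if_P[OF refl]
  proof
    fix p assume "p \<in> frontier ?S"
    then have "(1 / t) *\<^sub>R p \<in> frontier \<Omega>"
      using cl[of p] dilation_image_iff[OF \<open>0 < t\<close>, of p \<Omega>] S \<open>open \<Omega>\<close>
      by (simp add: frontier_def interior_open)
    then show "w p = 0" using u(6) by (simp add: w_def)
  qed
  ultimately show ?thesis
    unfolding robin_eigenvalue_def by blast
qed

lemma dirichlet_fundamental_eigenvalue_dilation: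
  assumes "open \<Omega>" "0 < t" "is_fundamental_eigenvalue 0 \<Omega> l"
  shows "is_fundamental_eigenvalue 0 ((\<lambda>x. t *\<^sub>R x) ` \<Omega>) (l / t\<^sup>2)"
  unfolding is_fundamental_eigenvalue_def
proof (intro conjI allI impI)
  show "robin_eigenvalue 0 ((\<lambda>x. t *\<^sub>R x) ` \<Omega>) (l / t\<^sup>2)"
    using assms by (intro dirichlet_eigenvalue_dilation) (auto simp: is_fundamental_eigenvalue_def)
  fix m assume m: "robin_eigenvalue 0 ((\<lambda>x. t *\<^sub>R x) ` \<Omega>) m"
  have "open ((\<lambda>x. t *\<^sub>R x) ` \<Omega>)" using assms by (intro open_scaling) auto
  from dirichlet_eigenvalue_dilation[OF this _ m, of "1 / t"]
  have "robin_eigenvalue 0 \<Omega> (m * t\<^sup>2)"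
    using \<open>0 < t\<close> by (simp add: image_image power_one_over)
  with assms(3) have "l \<le> m * t\<^sup>2" by (simp add: is_fundamental_eigenvalue_def)
  then show "l / t\<^sup>2 \<le> m" using \<open>0 < t\<close> by (simp add: pos_divide_le_eq)
qed

text \<open>A cosine product that is positive on a cube around the domain has a positive eigenvalue. By
  comparison, an eigenfunction for \<open>l \<le> 0\<close> would not vanish everywhere on the boundary.\<close>

lemma dirichlet_eigenvalue_pos:
  fixes \<Omega> :: "(real^'n) set"
  assumes "open \<Omega>" "bounded \<Omega>" "robin_eigenvalue 0 \<Omega> l"
  shows "0 < l"
proof (rule ccontr)
  assume "\<not> 0 < l"
  obtain u y where u: "C2_on \<Omega> u" "continuous_on (closure \<Omega>) u" "y \<in> \<Omega>" "u y \<noteq> 0"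
    "\<And>x. x \<in> \<Omega> \<Longrightarrow> laplacian u x + l * u x = 0" "\<And>p. p \<in> frontier \<Omega> \<Longrightarrow> u p = 0"
    using assms(3) by (auto simp: robin_eigenvalue_def robin_boundary_condition_def)
  obtain r where r: "0 < r" "\<And>x. x \<in> closure \<Omega> \<Longrightarrow> norm x \<le> r"
    using bounded_closure[OF \<open>bounded \<Omega>\<close>] unfolding bounded_pos by blast
  define \<mu> :: "'n \<Rightarrow> real" where "\<mu> = (\<lambda>_. pi / (4 * r))"
  have pos: "0 < cos_product \<mu> x" if "x \<in> closure \<Omega>" for x
  proof (rule cos_product_pos[of _ _ "\<lambda>_. r"])
    show "\<bar>x $ i\<bar> \<le> r" for i using component_le_norm_cart[of x i] r(2)[OF that] by linarith
  qed (use r(1) in \<open>auto simp: \<mu>_def\<close>)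
  have "0 < (\<Sum>k\<in>UNIV. (\<mu> k)\<^sup>2)" using r(1) by (intro sum_pos) (auto simp: \<mu>_def)
  with \<open>\<not> 0 < l\<close> have less: "l < (\<Sum>k\<in>UNIV. (\<mu> k)\<^sup>2)" by simp
  obtain z M where "z \<in> frontier \<Omega>" "0 < M" "\<bar>u z\<bar> = M * cos_product \<mu> z"
    using quotient_max_on_frontier[OF assms(1,2) u(1,2,5,3,4) C2_on_cos_product
        continuous_on_cos_product laplacian_cos_product pos less] by blast
  moreover from this have "0 < cos_product \<mu> z" using pos by (simp add: frontier_def)
  ultimately show False using u(6) by simp
qed

lemma fundamental_eigenvalue_eqI:
  assumes "is_fundamental_eigenvalue \<beta> \<Omega> l"
  shows "fundamental_eigenvalue \<beta> \<Omega> = l"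
proof -
  have "m = l" if "is_fundamental_eigenvalue \<beta> \<Omega> m" for m
    using assms that unfolding is_fundamental_eigenvalue_def by (blast intro: order_antisym)
  with assms have "(THE l. is_fundamental_eigenvalue \<beta> \<Omega> l) = l" by blast
  then show ?thesis using assms by (auto simp: fundamental_eigenvalue_def)
qed

lemma completely_monotone_inverse_square:
  assumes "0 \<le> K" and L: "\<And>t. 0 < t \<Longrightarrow> L t = K / t\<^sup>2"
  shows "completely_monotone L"
proof -
  \<comment> \<open>The \<open>n\<close>-th derivative of \<open>K / x\<^sup>2\<close>.\<close>
  define d where "d n x = (-1) ^ n * fact (Suc n) * K * (1 / x) ^ (n + 2)" for n and x :: real
  have d': "(d n has_real_derivative d (Suc n) x) (at x)" if "0 < x" for n x
  proof -
    have "((\<lambda>x. 1 / x) has_real_derivative - ((1 / x)\<^sup>2)) (at x)"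
      using that by (auto intro!: derivative_eq_intros simp: power2_eq_square)
    from DERIV_cmult[OF DERIV_power[OF this, of "n + 2"], of "(-1) ^ n * fact (Suc n) * K"]
    have "(d n has_real_derivative
        (-1) ^ n * fact (Suc n) * K * (real (n + 2) * (- ((1 / x)\<^sup>2) * (1 / x) ^ (n + 1)))) (at x)"
      by (simp add: d_def[abs_def])
    also have "(-1) ^ n * fact (Suc n) * K * (real (n + 2) * (- (q\<^sup>2) * q ^ (n + 1)))
        = (-1) ^ Suc n * fact (Suc (Suc n)) * K * q ^ (Suc n + 2)" for q :: real
      by (simp add: algebra_simps power2_eq_square)
    finally show ?thesis by (simp only: d_def[abs_def])
  qed
  have eq: "\<forall>x>0. (deriv ^^ n) L x = d n x" and
    der: "\<forall>x>0. ((deriv ^^ n) L has_real_derivative d (Suc n) x) (at x)" for n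
  proof -
    have step: "\<forall>x>0. ((deriv ^^ n) L has_real_derivative d (Suc n) x) (at x)"
      if "\<forall>x>0. (deriv ^^ n) L x = d n x" for n
    proof (intro allI impI)
      fix x :: real assume "0 < x"
      show "((deriv ^^ n) L has_real_derivative d (Suc n) x) (at x)"
        by (rule has_field_derivative_transform_within_open[OF d', of x "{0<..}"])
          (use \<open>0 < x\<close> that in auto)
    qed
    show "\<forall>x>0. (deriv ^^ n) L x = d n x"
    proof (induction n)
      case 0 show ?case using L by (simp add: d_def power_one_over power2_eq_square)
    next
      case (Suc n) show ?case using step[OF Suc] by (auto intro: DERIV_imp_deriv)
    qed
    then show "\<forall>x>0. ((deriv ^^ n) L has_real_derivative d (Suc n) x) (at x)" by (rule step)
  qed
  show ?thesis
    unfolding completely_monotone_def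
  proof (intro allI impI conjI)
    fix n and x :: real assume "0 < x"
    then show "(deriv ^^ n) L differentiable (at x)"
      using der real_differentiable_def by blast
    have "(-1) ^ n * (deriv ^^ n) L x = fact (Suc n) * K * (1 / x) ^ (n + 2)"
      using eq \<open>0 < x\<close> by (simp add: d_def flip: power_mult_distrib mult.assoc)
    then show "0 \<le> (-1) ^ n * (deriv ^^ n) L x" using \<open>0 \<le> K\<close> \<open>0 < x\<close> by simp
  qed
qed

section \<open>AG-convex and HA-convex functions\<close>

lemma convex_on_of_support_lines:
  fixes f :: "real \<Rightarrow> real"
  assumes "convex S" and supp: "\<And>c. c \<in> S \<Longrightarrow> \<exists>d. \<forall>z\<in>S. f c + d * (z - c) \<le> f z"
  shows "convex_on S f"
proof (rule convex_onI[OF _ \<open>convex S\<close>])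
  fix t x y :: real assume t: "0 < t" "t < 1" and xy: "x \<in> S" "y \<in> S"
  define c where "c = (1 - t) *\<^sub>R x + t *\<^sub>R y"
  have "c \<in> S" using convexD_alt[OF \<open>convex S\<close> xy, of t] t by (simp add: c_def)
  then obtain d where d: "\<And>z. z \<in> S \<Longrightarrow> f c + d * (z - c) \<le> f z" using supp by blast
  have "(1 - t) * (f c + d * (x - c)) + t * (f c + d * (y - c)) \<le> (1 - t) * f x + t * f y"
    using t d[OF xy(1)] d[OF xy(2)] by (intro add_mono mult_left_mono) auto
  moreover have "(1 - t) * (f c + d * (x - c)) + t * (f c + d * (y - c)) = f c"
    by (simp add: c_def algebra_simps)
  ultimately show "f ((1 - t) *\<^sub>R x + t *\<^sub>R y) \<le> (1 - t) * f x + t * f y"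
    by (simp add: c_def)
qed

text \<open>The slope of the curve \<open>(C y, M y)\<close> is \<open>D y\<close>. If it is monotone in the direction in which \<open>C\<close>
  increases, then \<open>M - D w * C\<close> is minimal at \<open>w\<close>, so that the curve lies above its tangents. This way
  the inverse function of \<open>C\<close> never has to be differentiated. The sign condition on \<open>D\<close> is stated so as
  to allow \<open>C\<close> to be increasing or decreasing.\<close>

lemma convex_on_parametric_curve:
  fixes f C M D :: "real \<Rightarrow> real"
  assumes C: "\<And>y. a < y \<Longrightarrow> y < b \<Longrightarrow> (C has_real_derivative C' y) (at y)"
    and M: "\<And>y. a < y \<Longrightarrow> y < b \<Longrightarrow> (M has_real_derivative D y * C' y) (at y)"
    and D: "\<And>w y. a < w \<Longrightarrow> w < b \<Longrightarrow> a < y \<Longrightarrow> y < b \<Longrightarrow> 0 \<le> (D y - D w) * C' y * (y - w)"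
    and surj: "\<And>c. c \<in> S \<Longrightarrow> \<exists>y. a < y \<and> y < b \<and> C y = c \<and> f c = M y"
    and "convex S"
  shows "convex_on S f"
proof (rule convex_on_of_support_lines[OF \<open>convex S\<close>])
  fix c assume "c \<in> S"
  then obtain w where w: "a < w" "w < b" "C w = c" "f c = M w" using surj by blast
  let ?h = "\<lambda>y. M y - D w * C y"
  have h': "(?h has_real_derivative (D y - D w) * C' y) (at y)" if "a < y" "y < b" for y
    using DERIV_diff[OF M[OF that] DERIV_cmult[OF C[OF that], of "D w"]] by (simp add: algebra_simps)
  have min: "?h w \<le> ?h y" if y: "a < y" "y < b" for y
  proof (cases "w \<le> y")
    case True
    show ?thesis
    proof (rule DERIV_nonneg_imp_nondecreasing[OF True])
      fix u assume u: "w \<le> u" "u \<le> y"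
      have "0 \<le> (D u - D w) * C' u"
        using D[of w u] w y u by (cases "u = w") (auto simp: zero_le_mult_iff)
      then show "\<exists>l. (?h has_real_derivative l) (at u) \<and> 0 \<le> l"
        using h'[of u] w y u by auto
    qed
  next
    case False
    show ?thesis
    proof (rule DERIV_nonpos_imp_nonincreasing[of y w ?h])
      fix u assume u: "y \<le> u" "u \<le> w"
      have "(D u - D w) * C' u \<le> 0"
        using D[of w u] w y u by (cases "u = w") (auto simp: zero_le_mult_iff)
      then show "\<exists>l. (?h has_real_derivative l) (at u) \<and> l \<le> 0"
        using h'[of u] w y u by auto
    qed (use False in simp)
  qed
  have "f c + D w * (z - c) \<le> f z" if "z \<in> S" for z
  proof -
    obtain y where y: "a < y" "y < b" "C y = z" "f z = M y" using surj[OF \<open>z \<in> S\<close>] by blast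
    show ?thesis using min[OF y(1,2)] y w by (simp add: algebra_simps)
  qed
  then show "\<exists>d. \<forall>z\<in>S. f c + d * (z - c) \<le> f z" by blast
qed

lemma convex_on_pos_cong:
  assumes "convex_on {0<..} f" "\<And>x::real. 0 < x \<Longrightarrow> f x = (g x :: real)"
  shows "convex_on {0<..} g"
proof (rule convex_onI)
  fix t x y :: real assume "0 < t" "t < 1" "x \<in> {0<..}" "y \<in> {0<..}"
  moreover from this have "0 < (1 - t) *\<^sub>R x + t *\<^sub>R y" by (simp add: add_pos_pos)
  ultimately show "g ((1 - t) *\<^sub>R x + t *\<^sub>R y) \<le> (1 - t) * g x + t * g y"
    using convex_onD[OF assms(1), of t x y] assms(2) by simp
qed simp

lemma convex_on_pos_scale:
  assumes "convex_on {0<..} f" "0 < (a::real)"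
  shows "convex_on {0<..} (\<lambda>x. f (x * a) :: real)"
proof (rule convex_onI)
  fix t x y :: real assume "0 < t" "t < 1" "x \<in> {0<..}" "y \<in> {0<..}"
  then show "f (((1 - t) *\<^sub>R x + t *\<^sub>R y) * a) \<le> (1 - t) * f (x * a) + t * f (y * a)"
    using convex_onD[OF assms(1), of t "x * a" "y * a"] \<open>0 < a\<close> by (simp add: algebra_simps)
qed simp

lemma AG_convex_cong:
  assumes "AG_convex f" "\<And>x. 0 < x \<Longrightarrow> f x = g x"
  shows "AG_convex g"
  using assms convex_on_pos_cong[of "\<lambda>x. ln (f x)" "\<lambda>x. ln (g x)"] by (auto simp: AG_convex_def)

lemma HA_convex_cong:
  assumes "HA_convex f" "\<And>x. 0 < x \<Longrightarrow> f x = g x"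
  shows "HA_convex g"
  using assms convex_on_pos_cong[of "\<lambda>x. f (1 / x)" "\<lambda>x. g (1 / x)"] by (auto simp: HA_convex_def)

lemma AG_convex_scale:
  assumes "AG_convex f" "0 < a"
  shows "AG_convex (\<lambda>x. f (x * a))"
  using assms convex_on_pos_scale[of "\<lambda>x. ln (f x)" a] by (simp add: AG_convex_def)

lemma HA_convex_scale:
  assumes "HA_convex f" "0 < a"
  shows "HA_convex (\<lambda>x. f (x * a))"
  using assms convex_on_pos_scale[of "\<lambda>x. f (1 / x)" "1 / a"] by (simp add: HA_convex_def)

lemma HA_convex_sum:
  assumes "finite I" "I \<noteq> {}" "\<And>i. i \<in> I \<Longrightarrow> HA_convex (f i)"
  shows "HA_convex (\<lambda>x. \<Sum>i\<in>I. f i x)"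
  unfolding HA_convex_def
proof (intro conjI allI impI)
  show "0 < (\<Sum>i\<in>I. f i x)" if "0 < x" for x
    using assms that by (intro sum_pos) (auto simp: HA_convex_def)
  show "convex_on {0<..} (\<lambda>x. \<Sum>i\<in>I. f i (1 / x))"
    using assms
  proof (induction I rule: finite_ne_induct)
    case (singleton i) then show ?case by (simp add: HA_convex_def)
  next
    case (insert i I)
    then show ?case by (simp add: HA_convex_def convex_on_add)
  qed
qed

text \<open>Multiplicative form of AG-convexity, for use in estimates of sums.\<close>

lemma AG_convex_iff:
  "AG_convex f \<longleftrightarrow> (\<forall>x>0. 0 < f x) \<and> (\<forall>t x y. 0 < t \<longrightarrow> t < 1 \<longrightarrow> 0 < x \<longrightarrow> 0 < y \<longrightarrow>
     f ((1 - t) * x + t * y) \<le> exp ((1 - t) * ln (f x) + t * ln (f y)))"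
proof (cases "\<forall>x>0. 0 < f x")
  case True
  have "convex_on {0<..} (\<lambda>x. ln (f x)) \<longleftrightarrow> (\<forall>t x y. 0 < t \<longrightarrow> t < 1 \<longrightarrow> 0 < x \<longrightarrow> 0 < y \<longrightarrow>
     ln (f ((1 - t) * x + t * y)) \<le> (1 - t) * ln (f x) + t * ln (f y))"
    (is "_ \<longleftrightarrow> ?R")
  proof
    assume "convex_on {0<..} (\<lambda>x. ln (f x))"
    from convex_onD[OF this] show ?R by simp
  next
    assume ?R then show "convex_on {0<..} (\<lambda>x. ln (f x))" by (intro convex_onI) auto
  qed
  moreover have "ln (f ((1 - t) * x + t * y)) \<le> r \<longleftrightarrow> f ((1 - t) * x + t * y) \<le> exp r"
    if "0 < t" "t < 1" "0 < x" "0 < y" for t x y r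
    using True that by (metis add_pos_pos diff_gt_0_iff_gt exp_gt_zero exp_le_cancel_iff exp_ln mult_pos_pos)
  ultimately show ?thesis using True by (simp add: AG_convex_def)
qed (auto simp: AG_convex_def)

lemma exp_weighted_mean_le:
  fixes u v t :: real
  assumes "0 \<le> t" "t \<le> 1"
  shows "exp ((1 - t) * u + t * v) \<le> (1 - t) * exp u + t * exp v"
  using convex_onD[OF exp_convex, of t u v] assms by simp

lemma AG_convex_imp_convex:
  assumes "AG_convex f"
  shows "convex_on {0<..} f"
proof (rule convex_onI)
  fix t x y :: real assume A: "0 < t" "t < 1" "x \<in> {0<..}" "y \<in> {0<..}"
  then have "f ((1 - t) * x + t * y) \<le> exp ((1 - t) * ln (f x) + t * ln (f y))"
    using assms by (simp add: AG_convex_iff)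
  also have "\<dots> \<le> (1 - t) * exp (ln (f x)) + t * exp (ln (f y))"
    using A by (intro exp_weighted_mean_le) auto
  also have "\<dots> = (1 - t) * f x + t * f y"
    using assms A by (simp add: AG_convex_def)
  finally show "f ((1 - t) *\<^sub>R x + t *\<^sub>R y) \<le> (1 - t) * f x + t * f y" by simp
qed simp

text \<open>Hoelder's inequality in disguise: after division by the sums \<open>F x\<close> and \<open>F y\<close>, the weighted geometric
  means of the summands are estimated by arithmetic means, which add up to \<open>1\<close>.\<close>

lemma AG_convex_sum:
  assumes "finite I" "I \<noteq> {}" and f: "\<And>i. i \<in> I \<Longrightarrow> AG_convex (f i)"
  shows "AG_convex (\<lambda>x. \<Sum>i\<in>I. f i x)"
  unfolding AG_convex_iff
proof (intro conjI allI impI)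
  have fpos: "0 < f i x" if "i \<in> I" "0 < x" for i x using f that by (simp add: AG_convex_def)
  then show pos: "0 < (\<Sum>i\<in>I. f i x)" if "0 < x" for x
    using assms that by (intro sum_pos) auto
  fix t x y :: real assume A: "0 < t" "t < 1" "0 < x" "0 < y"
  define F where "F = (\<lambda>x. \<Sum>i\<in>I. f i x)"
  have F: "0 < F x" "0 < F y" using pos A by (auto simp: F_def)
  define E where "E = exp ((1 - t) * ln (F x) + t * ln (F y))"
  have "f i ((1 - t) * x + t * y) \<le> E * ((1 - t) * (f i x / F x) + t * (f i y / F y))" if i: "i \<in> I" for i
  proof -
    have "f i ((1 - t) * x + t * y) \<le> exp ((1 - t) * ln (f i x) + t * ln (f i y))"
      using f[OF i] A by (simp add: AG_convex_iff)
    also have "\<dots> = E * exp ((1 - t) * ln (f i x / F x) + t * ln (f i y / F y))"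
      using F fpos[OF i A(3)] fpos[OF i A(4)]
      by (simp add: E_def ln_div algebra_simps flip: exp_add)
    also have "\<dots> \<le> E * ((1 - t) * exp (ln (f i x / F x)) + t * exp (ln (f i y / F y)))"
      using A by (intro mult_left_mono exp_weighted_mean_le) (auto simp: E_def)
    finally show ?thesis using F fpos[OF i A(3)] fpos[OF i A(4)] by simp
  qed
  then have "F ((1 - t) * x + t * y) \<le> (\<Sum>i\<in>I. E * ((1 - t) * (f i x / F x) + t * (f i y / F y)))"
    unfolding F_def by (rule sum_mono)
  also have "\<dots> = E * ((1 - t) * ((\<Sum>i\<in>I. f i x) / F x) + t * ((\<Sum>i\<in>I. f i y) / F y))"
    by (simp only: sum_distrib_left[symmetric] sum.distrib sum_divide_distrib[symmetric])
  also have "\<dots> = E * ((1 - t) * (F x / F x) + t * (F y / F y))"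
    by (simp only: F_def)
  also have "\<dots> = E" using F by simp
  finally show "(\<Sum>i\<in>I. f i ((1 - t) * x + t * y)) \<le>
      exp ((1 - t) * ln (\<Sum>i\<in>I. f i x) + t * ln (\<Sum>i\<in>I. f i y))"
    by (simp add: F_def E_def)
qed

section \<open>The wave number of an interval\<close>

lemma mult_cos_le_sin:
  assumes "0 \<le> w" "w \<le> pi"
  shows "w * cos w \<le> sin w"
proof -
  have "sin 0 - 0 * cos 0 \<le> sin w - w * cos w"
  proof (rule DERIV_nonneg_imp_nondecreasing[OF assms(1)])
    fix x :: real assume "0 \<le> x" "x \<le> w"
    then have "0 \<le> x * sin x" using assms by (intro mult_nonneg_nonneg sin_ge_zero) auto
    moreover have "((\<lambda>x. sin x - x * cos x) has_real_derivative x * sin x) (at x)"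
      by (auto intro!: derivative_eq_intros)
    ultimately show "\<exists>l. ((\<lambda>x. sin x - x * cos x) has_real_derivative l) (at x) \<and> 0 \<le> l" by blast
  qed
  then show ?thesis by simp
qed

text \<open>Both sides and their derivatives vanish at \<open>0\<close>, and the second derivative of the difference is
  \<open>4 sin h (sin h - h cos h)\<close> with \<open>h = z/2\<close>.\<close>

lemma square_plus_mult_sin_ge:
  assumes "0 \<le> z" "z \<le> 2 * pi"
  shows "4 - 4 * cos z \<le> z\<^sup>2 + z * sin z"
proof -
  let ?P = "\<lambda>z. z\<^sup>2 + z * sin z + 4 * cos z"
  let ?P' = "\<lambda>z. 2 * z + z * cos z - 3 * sin z"
  have P'_nonneg: "0 \<le> ?P' x" if x: "0 \<le> x" "x \<le> 2 * pi" for x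
  proof -
    have "?P' 0 \<le> ?P' x"
    proof (rule DERIV_nonneg_imp_nondecreasing[OF x(1)])
      fix u assume u: "0 \<le> u" "u \<le> x"
      define h where "h = u / 2"
      have h: "0 \<le> h" "h \<le> pi" "u = 2 * h" using u x by (auto simp: h_def)
      have "2 - 2 * cos u - u * sin u = 4 * (sin h * (sin h - h * cos h))"
        unfolding h(3) cos_double_sin sin_double by (simp add: algebra_simps power2_eq_square)
      moreover have "0 \<le> sin h * (sin h - h * cos h)"
        using mult_cos_le_sin[OF h(1,2)] sin_ge_zero[OF h(1,2)] by simp
      moreover have "(?P' has_real_derivative 2 - 2 * cos u - u * sin u) (at u)"
        by (auto intro!: derivative_eq_intros)
      ultimately show "\<exists>l. (?P' has_real_derivative l) (at u) \<and> 0 \<le> l" by auto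
    qed
    then show ?thesis by simp
  qed
  have "?P 0 \<le> ?P z"
  proof (rule DERIV_nonneg_imp_nondecreasing[OF assms(1)])
    fix x assume x: "0 \<le> x" "x \<le> z"
    have "(?P has_real_derivative ?P' x) (at x)"
      by (auto intro!: derivative_eq_intros)
    with P'_nonneg[of x] x assms(2) show "\<exists>l. (?P has_real_derivative l) (at x) \<and> 0 \<le> l" by auto
  qed
  then show ?thesis by simp
qed

lemma quarter_period_pos:
  assumes "0 < y" "y < pi / 2"
  shows "0 < sin y" "0 < cos y" "0 < tan y"
  using assms by (auto intro: sin_gt_zero cos_gt_zero tan_gt_zero)

text \<open>The right-hand side contains the derivative \<open>tan y + y / cos\<^sup>2 y\<close> of \<open>y tan y\<close>, which cancels when
  derivatives are taken along the curve.\<close>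

lemma sin_square_plus_mult_tan_factor:
  assumes "0 < y" "y < pi / 2"
  shows "(sin y)\<^sup>2 + y * tan y = sin y * cos y * (tan y + y / (cos y)\<^sup>2)"
  using quarter_period_pos[OF assms] by (simp add: tan_def field_simps power2_eq_square)

text \<open>This monotonicity is what HA-convexity of the squared wave number amounts to. Up to positive factors,
  the derivative is \<open>z\<^sup>2 + z sin z - 4 + 4 cos z\<close> at \<open>z = 4 x\<close>.\<close>

lemma sin_square_plus_mult_tan_div_square_mono:
  assumes "0 < w" "w \<le> y" "y < pi / 2"
  shows "((sin w)\<^sup>2 + w * tan w) / w\<^sup>2 \<le> ((sin y)\<^sup>2 + y * tan y) / y\<^sup>2"
proof (rule DERIV_nonneg_imp_nondecreasing[OF assms(2)])
  fix x assume "w \<le> x" "x \<le> y"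
  then have x: "0 < x" "x < pi / 2" using assms by auto
  note pos = quarter_period_pos[OF x]
  let ?N = "(2 * sin x * cos x + tan x + x / (cos x)\<^sup>2) * x\<^sup>2 - ((sin x)\<^sup>2 + x * tan x) * (2 * x)"
  have deriv: "((\<lambda>x. ((sin x)\<^sup>2 + x * tan x) / x\<^sup>2) has_real_derivative ?N / (x\<^sup>2 * x\<^sup>2)) (at x)"
    using x pos by (auto intro!: derivative_eq_intros simp: inverse_eq_divide)
  \<comment> \<open>Multiplied by \<open>cos\<^sup>2 x / x\<close>, the numerator \<open>?N\<close> becomes an expression in \<open>4 x\<close>.\<close>
  have sin4: "sin (4 * x) = 4 * sin x * cos x * (2 * (cos x)\<^sup>2 - 1)"
    using sin_double[of "2 * x"] by (simp add: sin_double cos_double_cos)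
  have cos4: "4 - 4 * cos (4 * x) = 32 * ((sin x)\<^sup>2 * (cos x)\<^sup>2)"
    using cos_double_sin[of "2 * x"] by (simp add: sin_double power_mult_distrib)
  have "0 \<le> (4 * x)\<^sup>2 + 4 * x * sin (4 * x) - (4 - 4 * cos (4 * x))"
    using square_plus_mult_sin_ge[of "4 * x"] x by simp
  also have "\<dots> = 16 * (?N * (cos x)\<^sup>2 / x)"
    unfolding sin4 cos4 using x pos by (simp add: tan_def field_simps power2_eq_square)
  finally have "0 \<le> ?N" using x pos by (simp add: zero_le_divide_iff zero_le_mult_iff)
  then have "0 \<le> ?N / (x\<^sup>2 * x\<^sup>2)" by simp
  with deriv show "\<exists>l. ((\<lambda>x. ((sin x)\<^sup>2 + x * tan x) / x\<^sup>2) has_real_derivative l) (at x) \<and> 0 \<le> l"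
    by blast
qed

lemma sin_square_plus_mult_tan_mono:
  assumes "0 < w" "w \<le> y" "y < pi / 2"
  shows "(sin w)\<^sup>2 + w * tan w \<le> (sin y)\<^sup>2 + y * tan y"
proof (intro add_mono power_mono mult_mono)
  show "sin w \<le> sin y" using assms by (intro sin_monotone_2pi_le) auto
  show "tan w \<le> tan y" using assms by (intro tan_mono_le) auto
  show "0 \<le> sin w" "0 \<le> tan w" using quarter_period_pos[of w] assms by auto
qed (use assms in auto)

text \<open>The equation is \<open>\<mu> tan (c \<mu>) = 1/\<beta>\<close> cleared of denominators, so that \<open>\<beta> = 0\<close>, where
  \<open>c \<mu> = \<pi>/2\<close>, needs no separate definition.\<close>

definition robin_wavenumber :: "real \<Rightarrow> real \<Rightarrow> real" where
  "robin_wavenumber \<beta> c = (SOME m. 0 < m \<and> m * c \<le> pi / 2 \<and> \<beta> * m * sin (m * c) = cos (m * c))"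

lemma
  assumes "0 \<le> \<beta>" "0 < c"
  shows robin_wavenumber_pos: "0 < robin_wavenumber \<beta> c"
    and robin_wavenumber_le: "robin_wavenumber \<beta> c * c \<le> pi / 2"
    and robin_wavenumber_eq: "\<beta> * robin_wavenumber \<beta> c * sin (robin_wavenumber \<beta> c * c) =
      cos (robin_wavenumber \<beta> c * c)"
proof -
  have "\<exists>y\<ge>0. y \<le> pi / 2 \<and> \<beta> * y * sin y - c * cos y = 0"
    by (rule IVT') (use assms in \<open>auto intro!: continuous_intros\<close>)
  then obtain y where y: "0 \<le> y" "y \<le> pi / 2" "\<beta> * y * sin y = c * cos y" by auto
  have "y \<noteq> 0" using y(3) assms by auto
  then have "0 < y / c \<and> y / c * c \<le> pi / 2 \<and> \<beta> * (y / c) * sin (y / c * c) = cos (y / c * c)"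
    using y assms by (simp add: field_simps)
  from someI[of "\<lambda>m. 0 < m \<and> m * c \<le> pi / 2 \<and> \<beta> * m * sin (m * c) = cos (m * c)", OF this]
  show "0 < robin_wavenumber \<beta> c" "robin_wavenumber \<beta> c * c \<le> pi / 2"
    "\<beta> * robin_wavenumber \<beta> c * sin (robin_wavenumber \<beta> c * c) = cos (robin_wavenumber \<beta> c * c)"
    unfolding robin_wavenumber_def by blast+
qed

lemma dirichlet_wavenumber:
  assumes "0 < c"
  shows "robin_wavenumber 0 c = pi / (2 * c)"
proof -
  have "cos (robin_wavenumber 0 c * c) = 0" using robin_wavenumber_eq[of 0 c] assms by simp
  moreover have "0 < robin_wavenumber 0 c * c" using robin_wavenumber_pos[of 0 c] assms by simp
  ultimately have "robin_wavenumber 0 c * c = pi / 2"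
    using robin_wavenumber_le[of 0 c] cos_gt_zero[of "robin_wavenumber 0 c * c"] assms by fastforce
  then show ?thesis using assms by (simp add: field_simps)
qed

lemma robin_wavenumber_parametrization:
  assumes "0 < \<beta>" "0 < c"
  obtains y where "0 < y" "y < pi / 2" "\<beta> * y * tan y = c" "robin_wavenumber \<beta> c = 1 / (\<beta> * tan y)"
proof -
  define m where "m = robin_wavenumber \<beta> c"
  define y where "y = m * c"
  have m: "0 < m" "y \<le> pi / 2" "\<beta> * m * sin y = cos y"
    using robin_wavenumber_pos[of \<beta> c] robin_wavenumber_le[of \<beta> c] robin_wavenumber_eq[of \<beta> c] assms
    by (auto simp: m_def y_def)
  have "y \<noteq> pi / 2"
  proof
    assume "y = pi / 2"
    with m(3) have "\<beta> * m = 0" by simp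
    with m(1) assms show False by simp
  qed
  then have y: "0 < y" "y < pi / 2" using m assms by (auto simp: y_def)
  note pos = quarter_period_pos[OF y]
  have "\<beta> * m * tan y = 1" using m(3) pos by (simp add: tan_def)
  then have "m = 1 / (\<beta> * tan y)" "\<beta> * y * tan y = c"
    using assms pos by (simp_all add: y_def field_simps)
  with that y show thesis by (simp add: m_def)
qed

lemma robin_wavenumber_strict_antimono:
  assumes "0 \<le> \<beta>" "0 < c" "c < d"
  shows "robin_wavenumber \<beta> d < robin_wavenumber \<beta> c"
proof (cases "\<beta> = 0")
  case True
  then show ?thesis using assms by (simp add: dirichlet_wavenumber frac_less2)
next
  case False
  then have "0 < \<beta>" "0 < d" using assms by auto
  obtain y where y: "0 < y" "y < pi / 2" "\<beta> * y * tan y = c" "robin_wavenumber \<beta> c = 1 / (\<beta> * tan y)"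
    using robin_wavenumber_parametrization[OF \<open>0 < \<beta>\<close> \<open>0 < c\<close>] by blast
  obtain z where z: "0 < z" "z < pi / 2" "\<beta> * z * tan z = d" "robin_wavenumber \<beta> d = 1 / (\<beta> * tan z)"
    using robin_wavenumber_parametrization[OF \<open>0 < \<beta>\<close> \<open>0 < d\<close>] by blast
  have "y < z"
  proof (rule ccontr)
    assume "\<not> y < z"
    then have "tan z \<le> tan y" using y z by (intro tan_mono_le) auto
    then have "\<beta> * z * tan z \<le> \<beta> * y * tan y"
      using \<open>\<not> y < z\<close> \<open>0 < \<beta>\<close> y z quarter_period_pos[of z] by (intro mult_mono) auto
    then show False using y z assms by simp
  qed
  then have "tan y < tan z" using y z by (intro tan_monotone) auto
  then show ?thesis
    unfolding y(4) z(4) using \<open>0 < \<beta>\<close> quarter_period_pos[OF y(1,2)]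
    by (intro divide_strict_left_mono) auto
qed

lemma AG_convex_robin_wavenumber_square:
  assumes "0 \<le> \<beta>"
  shows "AG_convex (\<lambda>c. (robin_wavenumber \<beta> c)\<^sup>2)"
  unfolding AG_convex_def
proof (intro conjI allI impI)
  show "0 < (robin_wavenumber \<beta> c)\<^sup>2" if "0 < c" for c
    using robin_wavenumber_pos[OF assms that] by simp
  show "convex_on {0<..} (\<lambda>c. ln ((robin_wavenumber \<beta> c)\<^sup>2))"
  proof (cases "\<beta> = 0")
    case True
    have "convex_on {0<..} (\<lambda>c. 2 * ln (pi / 2) - 2 * ln c)"
    proof (rule convex_on_realI[where f' = "\<lambda>c. - (2 / c)"])
      show "((\<lambda>c. 2 * ln (pi / 2) - 2 * ln c) has_real_derivative - (2 / x)) (at x)"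
        if "x \<in> {0<..}" for x using that by (auto intro!: derivative_eq_intros)
    qed (auto intro: divide_left_mono)
    then show ?thesis
      by (rule convex_on_pos_cong)
        (use True in \<open>simp add: dirichlet_wavenumber ln_realpow ln_div ln_mult\<close>)
  next
    case False
    with assms have "0 < \<beta>" by simp
    show ?thesis
    proof (rule convex_on_parametric_curve)
      fix y :: real assume y: "0 < y" "y < pi / 2"
      note pos = quarter_period_pos[OF y]
      show "((\<lambda>y. \<beta> * y * tan y) has_real_derivative \<beta> * (tan y + y / (cos y)\<^sup>2)) (at y)"
        using pos by (auto intro!: derivative_eq_intros simp: algebra_simps inverse_eq_divide)
      have Q: "0 < tan y + y / (cos y)\<^sup>2" using y pos by (simp add: add_pos_pos)
      have "- 2 / (sin y * cos y) =
          - 2 / (\<beta> * ((sin y)\<^sup>2 + y * tan y)) * (\<beta> * (tan y + y / (cos y)\<^sup>2))"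
      proof -
        have "- 2 / p = - 2 / (\<beta> * (p * q)) * (\<beta> * q)" if "0 < p" "0 < q" for p q :: real
          using that \<open>0 < \<beta>\<close> by simp
        note alg = this
        show ?thesis
          unfolding sin_square_plus_mult_tan_factor[OF y] by (rule alg) (use pos Q in simp_all)
      qed
      moreover have "((\<lambda>y. - 2 * ln (\<beta> * tan y)) has_real_derivative
          - 2 * (\<beta> * inverse ((cos y)\<^sup>2) / (\<beta> * tan y))) (at y)"
        using \<open>0 < \<beta>\<close> pos by (auto intro!: derivative_eq_intros)
      moreover have "- 2 * (\<beta> * inverse ((cos y)\<^sup>2) / (\<beta> * tan y)) = - 2 / (sin y * cos y)"
        using \<open>0 < \<beta>\<close> pos by (simp add: tan_def field_simps power2_eq_square)
      ultimately show "((\<lambda>y. - 2 * ln (\<beta> * tan y)) has_real_derivative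
          - 2 / (\<beta> * ((sin y)\<^sup>2 + y * tan y)) * (\<beta> * (tan y + y / (cos y)\<^sup>2))) (at y)"
        by (simp only:)
    next
      have mono: "- 2 / (\<beta> * ((sin w)\<^sup>2 + w * tan w)) \<le> - 2 / (\<beta> * ((sin y)\<^sup>2 + y * tan y))"
        if "0 < w" "w \<le> y" "y < pi / 2" for w y
      proof -
        have "0 < (sin w)\<^sup>2 + w * tan w" using quarter_period_pos[of w] that by (simp add: add_pos_pos)
        then have "2 / (\<beta> * ((sin y)\<^sup>2 + y * tan y)) \<le> 2 / (\<beta> * ((sin w)\<^sup>2 + w * tan w))"
          using sin_square_plus_mult_tan_mono[OF that] \<open>0 < \<beta>\<close>
          by (intro divide_left_mono mult_left_mono mult_pos_pos) auto
        then show ?thesis by simp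
      qed
      fix w y :: real assume wy: "0 < w" "w < pi / 2" "0 < y" "y < pi / 2"
      have Q: "0 \<le> \<beta> * (tan y + y / (cos y)\<^sup>2)"
        using \<open>0 < \<beta>\<close> quarter_period_pos[of y] wy by simp
      show "0 \<le> (- 2 / (\<beta> * ((sin y)\<^sup>2 + y * tan y)) - - 2 / (\<beta> * ((sin w)\<^sup>2 + w * tan w))) *
          (\<beta> * (tan y + y / (cos y)\<^sup>2)) * (y - w)"
      proof (cases "w \<le> y")
        case True
        with mono[of w y] wy show ?thesis
          by (intro mult_nonneg_nonneg[OF mult_nonneg_nonneg[OF _ Q]]) auto
      next
        case False
        with mono[of y w] wy show ?thesis
          by (intro mult_nonpos_nonpos[OF mult_nonpos_nonneg[OF _ Q]]) auto
      qed
    next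
      fix c :: real assume "c \<in> {0<..}"
      then obtain y where y: "0 < y" "y < pi / 2" "\<beta> * y * tan y = c"
        "robin_wavenumber \<beta> c = 1 / (\<beta> * tan y)"
        using robin_wavenumber_parametrization[of \<beta> c] \<open>0 < \<beta>\<close> by auto
      then have "ln ((robin_wavenumber \<beta> c)\<^sup>2) = - 2 * ln (\<beta> * tan y)"
        using \<open>0 < \<beta>\<close> quarter_period_pos[OF y(1,2)] by (simp add: ln_realpow ln_div)
      with y show "\<exists>y. 0 < y \<and> y < pi / 2 \<and> \<beta> * y * tan y = c \<and>
          ln ((robin_wavenumber \<beta> c)\<^sup>2) = - 2 * ln (\<beta> * tan y)"
        by blast
    qed simp
  qed
qed

lemma HA_convex_robin_wavenumber_square:
  assumes "0 \<le> \<beta>"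
  shows "HA_convex (\<lambda>c. (robin_wavenumber \<beta> c)\<^sup>2)"
  unfolding HA_convex_def
proof (intro conjI allI impI)
  show "0 < (robin_wavenumber \<beta> c)\<^sup>2" if "0 < c" for c
    using robin_wavenumber_pos[OF assms that] by simp
  show "convex_on {0<..} (\<lambda>s. (robin_wavenumber \<beta> (1 / s))\<^sup>2)"
  proof (cases "\<beta> = 0")
    case True
    have "convex_on {0<..} (\<lambda>s. (pi / 2 * s)\<^sup>2)"
    proof (rule convex_on_realI[where f' = "\<lambda>s. pi\<^sup>2 / 2 * s"])
      show "((\<lambda>s. (pi / 2 * s)\<^sup>2) has_real_derivative pi\<^sup>2 / 2 * x) (at x)" for x
        by (auto intro!: derivative_eq_intros simp: power2_eq_square)
    qed (auto intro: mult_left_mono)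
    then show ?thesis
      by (rule convex_on_pos_cong) (use True in \<open>simp add: dirichlet_wavenumber\<close>)
  next
    case False
    with assms have "0 < \<beta>" by simp
    let ?D = "\<lambda>y. 2 / \<beta> / (((sin y)\<^sup>2 + y * tan y) / y\<^sup>2)"
    let ?C' = "\<lambda>y. - (tan y + y / (cos y)\<^sup>2) / (\<beta> * (y * tan y)\<^sup>2)"
    show ?thesis
    proof (rule convex_on_parametric_curve)
      fix y :: real assume y: "0 < y" "y < pi / 2"
      note pos = quarter_period_pos[OF y]
      show "((\<lambda>y. 1 / (\<beta> * y * tan y)) has_real_derivative ?C' y) (at y)"
        using \<open>0 < \<beta>\<close> y pos
        by (auto intro!: derivative_eq_intros simp: inverse_eq_divide field_simps power2_eq_square)
      have Q: "0 < tan y + y / (cos y)\<^sup>2" using y pos by (simp add: add_pos_pos)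
      have "- 2 / (\<beta>\<^sup>2 * (sin y * cos y) * (tan y)\<^sup>2) = ?D y * ?C' y"
      proof -
        have "- 2 / (\<beta>\<^sup>2 * p * t\<^sup>2) = 2 / \<beta> / (p * q / y\<^sup>2) * (- q / (\<beta> * (y * t)\<^sup>2))"
          if "0 < p" "0 < q" "0 < t" for p q t :: real
          using that \<open>0 < \<beta>\<close> y by (simp add: field_simps power2_eq_square)
        note alg = this
        show ?thesis
          unfolding sin_square_plus_mult_tan_factor[OF y] by (rule alg) (use pos Q in simp_all)
      qed
      moreover have "((\<lambda>y. 1 / (\<beta> * tan y)\<^sup>2) has_real_derivative
          - (2 * (\<beta> * tan y) * (\<beta> * inverse ((cos y)\<^sup>2))) / ((\<beta> * tan y)\<^sup>2 * (\<beta> * tan y)\<^sup>2)) (at y)"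
        using \<open>0 < \<beta>\<close> pos by (auto intro!: derivative_eq_intros)
      moreover have "- (2 * (\<beta> * tan y) * (\<beta> * inverse ((cos y)\<^sup>2))) / ((\<beta> * tan y)\<^sup>2 * (\<beta> * tan y)\<^sup>2) =
          - 2 / (\<beta>\<^sup>2 * (sin y * cos y) * (tan y)\<^sup>2)"
        using \<open>0 < \<beta>\<close> pos by (simp add: tan_def field_simps power2_eq_square)
      ultimately show "((\<lambda>y. 1 / (\<beta> * tan y)\<^sup>2) has_real_derivative ?D y * ?C' y) (at y)"
        by (simp only:)
    next
      have anti: "?D y \<le> ?D w" if "0 < w" "w \<le> y" "y < pi / 2" for w y
      proof -
        have "0 < ((sin w)\<^sup>2 + w * tan w) / w\<^sup>2"
          using quarter_period_pos[of w] that by (simp add: add_pos_pos)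
        then show ?thesis
          using sin_square_plus_mult_tan_div_square_mono[OF that] \<open>0 < \<beta>\<close>
          by (intro divide_left_mono mult_pos_pos) auto
      qed
      fix w y :: real assume wy: "0 < w" "w < pi / 2" "0 < y" "y < pi / 2"
      have "0 < tan y + y / (cos y)\<^sup>2" using quarter_period_pos[of y] wy by (simp add: add_pos_pos)
      then have Q: "?C' y \<le> 0" using \<open>0 < \<beta>\<close> by (intro divide_nonpos_nonneg) (linarith, simp)
      show "0 \<le> (?D y - ?D w) * ?C' y * (y - w)"
      proof (cases "w \<le> y")
        case True
        with anti[of w y] wy show ?thesis
          by (intro mult_nonneg_nonneg[OF mult_nonpos_nonpos[OF _ Q]]) auto
      next
        case False
        with anti[of y w] wy show ?thesis
          by (intro mult_nonpos_nonpos[OF mult_nonneg_nonpos[OF _ Q]]) auto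
      qed
    next
      fix s :: real assume s: "s \<in> {0<..}"
      then obtain y where y: "0 < y" "y < pi / 2" "\<beta> * y * tan y = 1 / s"
        "robin_wavenumber \<beta> (1 / s) = 1 / (\<beta> * tan y)"
        using robin_wavenumber_parametrization[of \<beta> "1 / s"] \<open>0 < \<beta>\<close> by auto
      then have "1 / (\<beta> * y * tan y) = s" by simp
      moreover have "(robin_wavenumber \<beta> (1 / s))\<^sup>2 = 1 / (\<beta> * tan y)\<^sup>2"
        using y(4) by (simp add: power_one_over)
      ultimately show "\<exists>y. 0 < y \<and> y < pi / 2 \<and> 1 / (\<beta> * y * tan y) = s \<and>
          (robin_wavenumber \<beta> (1 / s))\<^sup>2 = 1 / (\<beta> * tan y)\<^sup>2"
        using y by blast
    qed simp
  qed
qed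

section \<open>Dilated boxes and domains\<close>

lemma dilation_symmetric_box:
  fixes a :: "real^'n"
  assumes "0 < t"
  shows "(\<lambda>x. t *\<^sub>R x) ` box (- a) a = box (- (t *\<^sub>R a)) (t *\<^sub>R a)"
proof (rule set_eqI)
  fix x :: "real^'n"
  have "\<bar>((1 / t) *\<^sub>R x) $ j\<bar> < a $ j \<longleftrightarrow> \<bar>x $ j\<bar> < (t *\<^sub>R a) $ j" for j
    using assms by (simp add: abs_mult pos_divide_less_eq mult.commute)
  then show "x \<in> (\<lambda>x. t *\<^sub>R x) ` box (- a) a \<longleftrightarrow> x \<in> box (- (t *\<^sub>R a)) (t *\<^sub>R a)"
    unfolding dilation_image_iff[OF assms] mem_symmetric_box by simp
qed

lemma box_fundamental_eigenvalue:
  fixes a :: "real^'n"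
  assumes "0 \<le> \<beta>" "\<And>j. 0 < a $ j" "0 < t"
  shows "is_fundamental_eigenvalue \<beta> ((\<lambda>x. t *\<^sub>R x) ` box (- a) a)
    (\<Sum>j\<in>UNIV. (robin_wavenumber \<beta> (t * a $ j))\<^sup>2)"
  unfolding dilation_symmetric_box[OF \<open>0 < t\<close>]
proof (rule is_fundamental_eigenvalue_box[OF _ assms(1)])
  fix j
  have pos: "0 < t * a $ j" using assms by simp
  then show "0 < (t *\<^sub>R a) $ j" by simp
  show "0 < robin_wavenumber \<beta> (t * a $ j)" by (rule robin_wavenumber_pos[OF assms(1) pos])
  show "robin_wavenumber \<beta> (t * a $ j) * (t *\<^sub>R a) $ j \<le> pi / 2"
    using robin_wavenumber_le[OF assms(1) pos] by simp
  show "\<beta> * robin_wavenumber \<beta> (t * a $ j) * sin (robin_wavenumber \<beta> (t * a $ j) * (t *\<^sub>R a) $ j) =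
      cos (robin_wavenumber \<beta> (t * a $ j) * (t *\<^sub>R a) $ j)"
    using robin_wavenumber_eq[OF assms(1) pos] by simp
qed

theorem theorem9:
  shows "(\<forall>(\<beta>::real) (a::real^'n). 0 \<le> \<beta> \<longrightarrow> (\<forall>j. 0 < a $ j) \<longrightarrow>
           (let \<Omega> = (\<lambda>t::real. (\<lambda>x. t *\<^sub>R x) ` box (- a) a);
                L = (\<lambda>t. fundamental_eigenvalue \<beta> (\<Omega> t))
            in (\<forall>t>0. is_fundamental_eigenvalue \<beta> (\<Omega> t) (L t)) \<and>
               strict_antimono_on {0<..} L \<and> convex_on {0<..} L \<and> AG_convex L \<and> HA_convex L)) \<and>
         (\<forall>\<Omega>1 :: (real^'n) set.
           open \<Omega>1 \<longrightarrow> \<Omega>1 \<noteq> {} \<longrightarrow> connected \<Omega>1 \<longrightarrow> bounded \<Omega>1 \<longrightarrow> simply_connected \<Omega>1 \<longrightarrow>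
           piecewise_C1_boundary \<Omega>1 \<longrightarrow>
           (let \<Omega> = (\<lambda>t::real. (\<lambda>x. t *\<^sub>R x) ` \<Omega>1);
                L = (\<lambda>t. fundamental_eigenvalue 0 (\<Omega> t))
            in completely_monotone L \<and>
               ((\<exists>l. is_fundamental_eigenvalue 0 \<Omega>1 l) \<longrightarrow>
                 (\<forall>t>0. is_fundamental_eigenvalue 0 (\<Omega> t) (L t) \<and> 0 < L t))))"
proof (intro conjI allI impI)
  fix \<beta> :: real and a :: "real^'n"
  assume \<beta>: "0 \<le> \<beta>" and "\<forall>j. 0 < a $ j"
  then have a: "0 < a $ j" for j by simp
  define L where "L t = fundamental_eigenvalue \<beta> ((\<lambda>x. t *\<^sub>R x) ` box (- a) a)" for t
  define F where "F t = (\<Sum>j\<in>UNIV. (robin_wavenumber \<beta> (t * a $ j))\<^sup>2)" for t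
  have fund: "is_fundamental_eigenvalue \<beta> ((\<lambda>x. t *\<^sub>R x) ` box (- a) a) (F t)" if "0 < t" for t
    unfolding F_def by (rule box_fundamental_eigenvalue[OF \<beta> a that])
  have L: "F t = L t" if "0 < t" for t
    using fundamental_eigenvalue_eqI[OF fund[OF that]] by (simp add: L_def)
  have "strict_antimono_on {0<..} L"
  proof (rule monotone_onI)
    fix s t :: real assume st: "s \<in> {0<..}" "t \<in> {0<..}" "s < t"
    have "F t < F s"
      unfolding F_def
    proof (rule sum_strict_mono)
      fix j
      have "robin_wavenumber \<beta> (t * a $ j) < robin_wavenumber \<beta> (s * a $ j)"
        using st a[of j] by (intro robin_wavenumber_strict_antimono[OF \<beta>]) auto
      then show "(robin_wavenumber \<beta> (t * a $ j))\<^sup>2 < (robin_wavenumber \<beta> (s * a $ j))\<^sup>2"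
        using robin_wavenumber_pos[OF \<beta>, of "t * a $ j"] st a[of j]
        by (intro power_strict_mono) auto
    qed auto
    then show "L s > L t" using L st by simp
  qed
  moreover have AG: "AG_convex L"
  proof (rule AG_convex_cong[OF _ L])
    show "AG_convex F"
      unfolding F_def
      by (intro AG_convex_sum AG_convex_scale[OF AG_convex_robin_wavenumber_square[OF \<beta>] a]) auto
  qed
  moreover have "HA_convex L"
  proof (rule HA_convex_cong[OF _ L])
    show "HA_convex F"
      unfolding F_def
      by (intro HA_convex_sum HA_convex_scale[OF HA_convex_robin_wavenumber_square[OF \<beta>] a]) auto
  qed
  moreover have "\<forall>t>0. is_fundamental_eigenvalue \<beta> ((\<lambda>x. t *\<^sub>R x) ` box (- a) a) (L t)"
    using fund L by simp
  ultimately show "let \<Omega> = (\<lambda>t::real. (\<lambda>x. t *\<^sub>R x) ` box (- a) a);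
        L = (\<lambda>t. fundamental_eigenvalue \<beta> (\<Omega> t))
      in (\<forall>t>0. is_fundamental_eigenvalue \<beta> (\<Omega> t) (L t)) \<and>
         strict_antimono_on {0<..} L \<and> convex_on {0<..} L \<and> AG_convex L \<and> HA_convex L"
    using AG_convex_imp_convex[OF AG] unfolding Let_def L_def[abs_def] by blast
next
  fix \<Omega>1 :: "(real^'n) set"
  assume \<Omega>: "open \<Omega>1" "bounded \<Omega>1"
  let ?\<Omega> = "\<lambda>t. (\<lambda>x. t *\<^sub>R x) ` \<Omega>1"
  define L where "L t = fundamental_eigenvalue 0 (?\<Omega> t)" for t
  have "completely_monotone L \<and> ((\<exists>l. is_fundamental_eigenvalue 0 \<Omega>1 l) \<longrightarrow>
      (\<forall>t>0. is_fundamental_eigenvalue 0 (?\<Omega> t) (L t) \<and> 0 < L t))"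
  proof (cases "\<exists>l. is_fundamental_eigenvalue 0 \<Omega>1 l")
    case True
    then obtain l where l: "is_fundamental_eigenvalue 0 \<Omega>1 l" by blast
    have "0 < l"
      using dirichlet_eigenvalue_pos[OF \<Omega>] l by (simp add: is_fundamental_eigenvalue_def)
    have fund: "is_fundamental_eigenvalue 0 (?\<Omega> t) (l / t\<^sup>2)" if "0 < t" for t
      by (rule dirichlet_fundamental_eigenvalue_dilation[OF \<Omega>(1) that l])
    have L: "L t = l / t\<^sup>2" if "0 < t" for t
      unfolding L_def by (rule fundamental_eigenvalue_eqI[OF fund[OF that]])
    have "completely_monotone L"
      using \<open>0 < l\<close> L by (intro completely_monotone_inverse_square) auto
    with fund L \<open>0 < l\<close> show ?thesis by simp
  next
    case False
    have "\<not> is_fundamental_eigenvalue 0 (?\<Omega> t) m" if "0 < t" for t m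
    proof
      assume m: "is_fundamental_eigenvalue 0 (?\<Omega> t) m"
      have "open (?\<Omega> t)" using \<Omega>(1) that by (intro open_scaling) auto
      from dirichlet_fundamental_eigenvalue_dilation[OF this _ m, of "1 / t"] that False
      show False by (simp add: image_image)
    qed
    then have "L t = 0 / t\<^sup>2" if "0 < t" for t
      using that by (simp add: L_def fundamental_eigenvalue_def)
    then have "completely_monotone L" by (intro completely_monotone_inverse_square) auto
    with False show ?thesis by blast
  qed
  then show "let \<Omega> = ?\<Omega>; L = (\<lambda>t. fundamental_eigenvalue 0 (\<Omega> t))
      in completely_monotone L \<and> ((\<exists>l. is_fundamental_eigenvalue 0 \<Omega>1 l) \<longrightarrow>
         (\<forall>t>0. is_fundamental_eigenvalue 0 (\<Omega> t) (L t) \<and> 0 < L t))"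
    unfolding Let_def L_def[abs_def] .
qed

end
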